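(* For a nonnegative integer $n$, let $p_{3,3}(n)$ be defined by $\sum_{n\geq0}p_{3,3}(n)q^n=\frac{1}{(q;q)_\infty^3(q^3;q^3)_\infty^3}$. Then for all integers $n\geq0$ and $\alpha\geq1$, \begin{align*} p_{3,3}\left(3^{\alpha}n+\tfrac{3^{\alpha}+1}{2}\right) &\equiv0\pmod{3^{\alpha+1}},\\ p_{3,3}\left(3^{\alpha+1}n+\tfrac{5\cdot3^{\alpha}+1}{2}\right) &\equiv0\pmod{3^{\alpha+4}}. \end{align*}
   Context: $(a;q)_\infty=\prod_{n\ge0}(1-aq^n)$. $p_{3,3}(n)$ counts 2-color partition triples of $n$ where one of the colors appears only in parts that are multiples of $3$. *)

theory Defs
  imports "HOL-Analysis.Infinite_Products" "HOL-Computational_Algebra.Formal_Power_Series"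
    "HOL-Number_Theory.Cong"
begin

text \<open>
  The product is formal: its limit is taken in the metric (X-adic) topology of formal power
  series. It converges when both arguments have zero constant coefficient, see
  \<open>has_prod_qpoch_inf\<close> below.
\<close>

definition qpoch_inf :: "'a::comm_ring_1 fps \<Rightarrow> 'a fps \<Rightarrow> 'a fps" where
  "qpoch_inf a q = (\<Prod>n. 1 - a * q ^ n)"

definition p33_denom :: "int fps" where
  "p33_denom = qpoch_inf fps_X fps_X ^ 3 * qpoch_inf (fps_X ^ 3) (fps_X ^ 3) ^ 3"

text \<open>
  Division on formal power series is only available over fields, so the reciprocal
  in \<open>\<int>[[q]]\<close> is written with \<open>fps_right_inverse\<close>, whose second argument
  is the inverse of the constant coefficient. That this is the reciprocal is the lemma
  \<open>p33_generating_function\<close>.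
\<close>

definition p33 :: "nat \<Rightarrow> int" where
  "p33 n = fps_nth (fps_right_inverse p33_denom 1) n"

lemma has_prod_qpoch_inf_aux:
  fixes a q :: "'a::idom fps"
  assumes a: "fps_nth a 0 = 0" and q: "fps_nth q 0 = 0"
  shows "(\<lambda>n. 1 - a * q ^ n) has_prod qpoch_inf a q \<and> fps_nth (qpoch_inf a q) 0 = 1"
proof -
  define P where "P n = (\<Prod>i\<le>n. 1 - a * q ^ i)" for n
  define L where "L = Abs_fps (\<lambda>k. fps_nth (P k) k)"
  have step: "fps_nth (P (Suc m)) k = fps_nth (P m) k" if "k \<le> m" for m k
  proof -
    have "fps_nth (q ^ Suc m * (P m * a)) k = 0"
      unfolding fps_mult_nth
      by (rule sum.neutral) (use that q startsby_zero_power_prefix[OF q, of "Suc m"] in auto)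
    moreover have "P (Suc m) = P m - q ^ Suc m * (P m * a)"
      by (simp add: P_def algebra_simps)
    ultimately show ?thesis by simp
  qed
  have stable: "fps_nth (P m) k = fps_nth (P k) k" if "k \<le> m" for m k
    using that by (induction m rule: dec_induct) (simp_all add: step)
  have lim: "P \<longlonglongrightarrow> L"
    by (rule tendsto_fpsI)
       (auto simp: L_def eventually_at_top_linorder intro!: exI stable)
  have L0: "fps_nth L 0 = 1"
    using a by (simp add: L_def P_def)
  hence "L \<noteq> 0" by auto
  with lim have "(\<lambda>n. 1 - a * q ^ n) has_prod L"
    by (simp add: has_prod_def raw_has_prod_def P_def[abs_def])
  moreover from this have "qpoch_inf a q = L"
    unfolding qpoch_inf_def by (rule has_prod_unique[symmetric])
  ultimately show ?thesis using L0 by simp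
qed

lemmas has_prod_qpoch_inf = has_prod_qpoch_inf_aux[THEN conjunct1]
lemmas qpoch_inf_nth_0 = has_prod_qpoch_inf_aux[THEN conjunct2]

lemma p33_generating_function: "Abs_fps p33 * p33_denom = 1"
proof -
  have "fps_nth p33_denom 0 = 1"
    by (simp add: p33_denom_def qpoch_inf_nth_0 fps_power_zeroth)
  hence "p33_denom * fps_right_inverse p33_denom 1 = 1"
    by (intro fps_right_inverse) simp
  moreover have "Abs_fps p33 = fps_right_inverse p33_denom 1"
    by (simp add: fps_eq_iff p33_def)
  ultimately show ?thesis by (simp add: mult.commute)
qed

end

theory Submission
  imports Defs "HOL-Computational_Algebra.Polynomial"
begin

text \<open>
  Write \<open>E\<^sub>k = (q\<^sup>k;q\<^sup>k)\<^sub>\<infinity>\<close>, \<open>z = q E\<^sub>9\<^sup>3/E\<^sub>1\<^sup>3\<close>, \<open>t = q E\<^sub>3\<^sup>1\<^sup>2/E\<^sub>1\<^sup>1\<^sup>2\<close>, and let \<open>U\<close> pick out the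
  coefficients with index divisible by 3. Jacobi's identity for \<open>E\<^sub>1\<^sup>3\<close> gives the trisection
  \<open>E\<^sub>1\<^sup>3 = P(q\<^sup>3) - 3 q E\<^sub>9\<^sup>3\<close>, and its norm over the cube roots of unity yields
  \<open>z\<^sup>3 = t(q\<^sup>3) (1 + 9z + 27z\<^sup>2)\<close> and \<open>t = z (1 + 9z + 27z\<^sup>2)\<close>. If \<open>F\<close> is the generating function of
  \<open>p33\<close> along the progression for \<open>\<alpha>\<close>, then \<open>G = q E\<^sub>1\<^sup>3 E\<^sub>3\<^sup>3 F\<close> satisfies \<open>G = 9t\<close> for \<open>\<alpha> = 1\<close>, and passing
  from \<open>\<alpha>\<close> to \<open>\<alpha> + 1\<close> replaces \<open>G\<close> by \<open>U(zG)\<close>. Since \<open>U\<close> maps \<open>z t \<int>[9t]\<close> into \<open>3t \<int>[9t]\<close>, induction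
  shows that \<open>G\<close> lies in \<open>3\<close> to the power \<open>\<alpha> + 1\<close> times \<open>t \<int>[9t]\<close>. For the second congruence, the
  coefficients of the elements of \<open>z t \<int>[9t]\<close> with index 1 mod 3 are divisible by 27.
\<close>

subsection \<open>Trisection of power series\<close>

definition trisect :: "nat \<Rightarrow> 'a fps \<Rightarrow> 'a fps" where
  "trisect r f = Abs_fps (\<lambda>n. fps_nth f (3 * n + r))"

abbreviation dilate3 :: "'a::comm_ring_1 fps \<Rightarrow> 'a fps" where
  "dilate3 f \<equiv> fps_compose f (fps_X ^ 3)"

lemma nat_mod_3_cases:
  fixes n :: nat
  obtains k where "n = 3 * k" | k where "n = 3 * k + 1" | k where "n = 3 * k + 2"
proof -
  have "n = 3 * (n div 3) \<or> n = 3 * (n div 3) + 1 \<or> n = 3 * (n div 3) + 2" by presburger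
  then show ?thesis using that by blast
qed

lemma trisect_nth [simp]: "fps_nth (trisect r f) n = fps_nth f (3 * n + r)"
  by (simp add: trisect_def)

lemma trisect_add [simp]: "trisect r (f + g) = trisect r f + trisect r g"
  and trisect_diff [simp]: "trisect r (f - g) = trisect r f - trisect r g"
  by (simp_all add: fps_eq_iff)

lemma trisect_sum: "trisect r (\<Sum>i\<in>A. f i) = (\<Sum>i\<in>A. trisect r (f i))"
  by (simp add: fps_eq_iff fps_sum_nth)

lemma trisect_const_mult [simp]:
  fixes f :: "'a::comm_ring_1 fps"
  shows "trisect r (of_int c * f) = of_int c * trisect r f"
    and "trisect r (numeral w * f) = numeral w * trisect r f"
  by (simp_all add: fps_eq_iff fps_numeral_fps_const flip: fps_of_int)

lemma dilate3_nth: "fps_nth (dilate3 f) n = (if 3 dvd n then fps_nth f (n div 3) else 0)"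
proof -
  have "fps_nth (dilate3 f) n = (\<Sum>i\<in>{0..n}. if n = 3 * i then fps_nth f i else 0)"
    unfolding fps_compose_nth
    by (intro sum.cong) (auto simp: fps_X_power_nth simp flip: power_mult)
  also have "\<dots> = (\<Sum>i\<in>{i\<in>{0..n}. n = 3 * i}. fps_nth f i)"
    by (subst sum.inter_filter) auto
  also have "\<dots> = (if 3 dvd n then fps_nth f (n div 3) else 0)"
  proof (cases "3 dvd n")
    case True
    then have "{i\<in>{0..n}. n = 3 * i} = {n div 3}" by auto
    with True show ?thesis by simp
  next
    case False
    then have "{i\<in>{0..n}. n = 3 * i} = {}" by auto
    with False show ?thesis by (simp only: sum.empty if_False)
  qed
  finally show ?thesis .
qed

text \<open>Only indices divisible by 3 of the first factor enter the Cauchy product, so series in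
  \<open>q^3\<close> act as scalars on every section.\<close>

lemma trisect_dilate3_mult:
  assumes "r < 3"
  shows "trisect r (dilate3 f * g) = f * trisect r g"
proof (rule fps_ext)
  fix n
  have "fps_nth (trisect r (dilate3 f * g)) n =
      (\<Sum>i\<in>{0..3 * n + r}. fps_nth (dilate3 f) i * fps_nth g (3 * n + r - i))"
    by (simp add: fps_mult_nth)
  also have "\<dots> = (\<Sum>i\<in>(*) 3 ` {0..n}. fps_nth (dilate3 f) i * fps_nth g (3 * n + r - i))"
  proof (rule sum.mono_neutral_right)
    show "\<forall>i\<in>{0..3 * n + r} - (*) 3 ` {0..n}.
        fps_nth (dilate3 f) i * fps_nth g (3 * n + r - i) = 0"
    proof
      fix i assume i: "i \<in> {0..3 * n + r} - (*) 3 ` {0..n}"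
      have "\<not> 3 dvd i"
      proof
        assume "3 dvd i"
        then obtain j where "i = 3 * j" ..
        with i assms show False by auto
      qed
      then show "fps_nth (dilate3 f) i * fps_nth g (3 * n + r - i) = 0"
        by (simp add: dilate3_nth)
    qed
  qed auto
  also have "\<dots> = (\<Sum>j\<in>{0..n}. fps_nth f j * fps_nth g (3 * (n - j) + r))"
    by (subst sum.reindex)
       (auto simp: inj_on_def dilate3_nth diff_mult_distrib2 intro!: sum.cong)
  finally show "fps_nth (trisect r (dilate3 f * g)) n = fps_nth (f * trisect r g) n"
    by (simp add: fps_mult_nth)
qed

lemma trisect_X_mult:
  fixes f :: "'a::comm_ring_1 fps"
  shows "trisect 0 (fps_X * f) = fps_X * trisect 2 f"
    and "trisect (Suc 0) (fps_X * f) = trisect 0 f"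
    and "trisect 2 (fps_X * f) = trisect (Suc 0) f"
  by (auto simp: fps_eq_iff intro!: arg_cong[of _ _ "fps_nth f"])

lemma trisect_dilate3:
  "trisect 0 (dilate3 f) = f" "trisect (Suc 0) (dilate3 f) = 0" "trisect 2 (dilate3 f) = 0"
proof -
  have "\<not> 3 dvd Suc (3 * n)" "\<not> 3 dvd Suc (Suc (3 * n))" for n by presburger+
  then show "trisect (Suc 0) (dilate3 f) = 0" "trisect 2 (dilate3 f) = 0"
    by (simp_all add: fps_eq_iff dilate3_nth)
qed (simp add: fps_eq_iff dilate3_nth)

lemma trisect_decomp:
  "f = dilate3 (trisect 0 f) + fps_X * dilate3 (trisect (Suc 0) f) + fps_X ^ 2 * dilate3 (trisect 2 f)"
proof (rule fps_ext)
  fix n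
  show "fps_nth f n = fps_nth (dilate3 (trisect 0 f) + fps_X * dilate3 (trisect (Suc 0) f)
      + fps_X ^ 2 * dilate3 (trisect 2 f)) n"
  proof (cases n rule: nat_mod_3_cases)
    case (1 k)
    then have "\<not> 3 dvd n - 1 \<or> n = 0" "\<not> 3 dvd n - 2 \<or> n < 2" by presburger+
    with 1 show ?thesis by (auto simp: dilate3_nth fps_X_power_mult_nth)
  next
    case (2 k)
    then have "\<not> 3 dvd n" "\<not> 3 dvd n - 2 \<or> n < 2" by presburger+
    with 2 show ?thesis by (auto simp: dilate3_nth fps_X_power_mult_nth)
  next
    case (3 k)
    then have "\<not> 3 dvd n" "\<not> 3 dvd n - 1" by presburger+
    with 3 show ?thesis by (auto simp: dilate3_nth fps_X_power_mult_nth)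
  qed
qed

lemma dilate3_mult: "dilate3 (f * g) = dilate3 f * dilate3 (g :: 'a::idom fps)"
  by (rule fps_compose_mult_distrib) simp

lemma dilate3_power: "dilate3 (f ^ n) = dilate3 (f :: 'a::idom fps) ^ n"
  by (rule fps_compose_power [symmetric]) simp

lemma dilate3_hom [simp]:
  fixes f g :: "'a::idom fps"
  shows "dilate3 (f + g) = dilate3 f + dilate3 g" "dilate3 (f - g) = dilate3 f - dilate3 g"
    "dilate3 1 = (1 :: 'a fps)" "dilate3 (numeral w) = (numeral w :: 'a fps)"
    "dilate3 fps_X = (fps_X ^ 3 :: 'a fps)"
  by (simp_all add: fps_compose_add_distrib fps_compose_sub_distrib fps_numeral_fps_const)

lemma trisect_dilate3_X:
  fixes f :: "'a::comm_ring_1 fps"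
  shows "trisect 0 (fps_X * dilate3 f) = 0"
    "trisect (Suc 0) (fps_X * dilate3 f) = f"
    "trisect 2 (fps_X * dilate3 f) = 0"
    "trisect 0 (fps_X ^ 2 * dilate3 f) = 0"
    "trisect (Suc 0) (fps_X ^ 2 * dilate3 f) = 0"
    "trisect 2 (fps_X ^ 2 * dilate3 f) = f"
  by (simp_all add: power2_eq_square mult.assoc trisect_X_mult trisect_dilate3)

text \<open>Multiplication in the basis \<open>1, X, X^2\<close> over series in \<open>X^3\<close>:
  where exponents wrap past 3, a factor \<open>X^3\<close> appears, which becomes \<open>X\<close>
  on the sections.\<close>

lemma trisect_mult:
  fixes f g :: "'a::comm_ring_1 fps"
  shows "trisect 0 (f * g) = trisect 0 f * trisect 0 g
      + fps_X * (trisect (Suc 0) f * trisect 2 g + trisect 2 f * trisect (Suc 0) g)" (is ?A)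
    and "trisect (Suc 0) (f * g) = trisect 0 f * trisect (Suc 0) g + trisect (Suc 0) f * trisect 0 g
      + fps_X * (trisect 2 f * trisect 2 g)" (is ?B)
    and "trisect 2 (f * g) = trisect 0 f * trisect 2 g + trisect (Suc 0) f * trisect (Suc 0) g
      + trisect 2 f * trisect 0 g" (is ?C)
proof -
  have *: "f * g = dilate3 (trisect 0 f) * g + dilate3 (trisect (Suc 0) f) * (fps_X * g)
      + dilate3 (trisect 2 f) * (fps_X * (fps_X * g))"
    by (subst trisect_decomp[of f]) (simp add: algebra_simps power2_eq_square)
  have V: "trisect 0 (dilate3 h * k) = h * trisect 0 k"
    "trisect (Suc 0) (dilate3 h * k) = h * trisect (Suc 0) k"
    "trisect 2 (dilate3 h * k) = h * trisect 2 k" for h k :: "'a fps"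
    by (simp_all add: trisect_dilate3_mult)
  show ?A ?B
    by (subst *, simp only: V trisect_add trisect_X_mult, simp add: algebra_simps)+
  show ?C
    by (subst *, simp only: V trisect_add trisect_X_mult)
qed

lemma trisect_1 [simp]: "trisect 0 1 = 1" "trisect (Suc 0) 1 = 0" "trisect 2 1 = 0"
  by (auto simp: fps_eq_iff)

lemma trisect_X_power:
  assumes "r < 3"
  shows "trisect r (fps_X ^ k) = (if k mod 3 = r then fps_X ^ (k div 3) else 0)"
  using assms by (auto simp: fps_eq_iff fps_X_power_nth)

text \<open>
  The product of \<open>f(q)\<close>, \<open>f(\<omega>q)\<close> and \<open>f(\<omega>\<^sup>2q)\<close> for a primitive cube root of
  unity \<open>\<omega>\<close>, rewritten as a power series in \<open>q\<^sup>3\<close>, in which \<open>q\<^sup>3\<close> is then renamed to \<open>q\<close>.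
\<close>

definition trinorm :: "'a::comm_ring_1 fps \<Rightarrow> 'a fps" where
  "trinorm f = trisect 0 f ^ 3 + fps_X * trisect (Suc 0) f ^ 3 + fps_X ^ 2 * trisect 2 f ^ 3
     - 3 * fps_X * trisect 0 f * trisect (Suc 0) f * trisect 2 f"

text \<open>After \<open>trisect_mult\<close> this is a polynomial identity in \<open>X\<close> and
  the six sections, so no root of unity has to be adjoined.\<close>

lemma trinorm_mult: "trinorm (f * g) = trinorm f * trinorm g"
  unfolding trinorm_def trisect_mult
  by (simp add: algebra_simps power2_eq_square power3_eq_cube)

lemma trinorm_one [simp]: "trinorm 1 = 1"
  by (simp add: trinorm_def)

lemma trinorm_power: "trinorm (f ^ n) = trinorm f ^ n"
  by (induction n) (simp_all add: trinorm_mult)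

text \<open>If 3 divides \<open>n\<close>, the three conjugates of \<open>1 - q^n\<close> coincide;
  otherwise they multiply to \<open>1 - q^(3n)\<close>, and \<open>q^3\<close> is renamed to
  \<open>q\<close>.\<close>

lemma trinorm_one_minus_X_power:
  "trinorm (1 - fps_X ^ n :: int fps) =
     (if 3 dvd n then (1 - fps_X ^ (n div 3)) ^ 3 else 1 - fps_X ^ n)"
proof (cases n rule: nat_mod_3_cases)
  case (1 k)
  then show ?thesis by (simp add: trinorm_def trisect_X_power)
next
  case (2 k)
  then have "\<not> 3 dvd n" "n mod 3 = 1" "n div 3 = k" by presburger+
  then show ?thesis
    by (simp add: trinorm_def trisect_X_power) (simp add: 2 power_mult mult.commute[of 3])
next
  case (3 k)
  then have "\<not> 3 dvd n" "n mod 3 = 2" "n div 3 = k" by presburger+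
  then show ?thesis
    by (simp add: trinorm_def trisect_X_power)
      (simp add: 3 power_mult mult.commute[of 3] power2_eq_square)
qed

subsection \<open>The Euler product and its norm\<close>

text \<open>Divisibility of a difference by \<open>X^m\<close> serves below as congruence modulo
  \<open>X^m\<close>, which turns limits of products into ring arithmetic.\<close>

lemma fps_X_power_dvd_iff:
  "fps_X ^ m dvd (f :: 'a::comm_ring_1 fps) \<longleftrightarrow> (\<forall>k<m. fps_nth f k = 0)"
proof
  assume "fps_X ^ m dvd f"
  then show "\<forall>k<m. fps_nth f k = 0"
    by (auto simp: dvd_def fps_X_power_mult_nth)
next
  assume "\<forall>k<m. fps_nth f k = 0"
  then have "f = fps_X ^ m * Abs_fps (\<lambda>n. fps_nth f (n + m))"
    by (auto simp: fps_eq_iff fps_X_power_mult_nth)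
  then show "fps_X ^ m dvd f" by (metis dvd_triv_left)
qed

lemma fps_eqI_X_power_dvd:
  fixes f g :: "'a::comm_ring_1 fps"
  assumes "\<And>m. fps_X ^ m dvd f - g"
  shows "f = g"
proof (rule fps_ext)
  fix n
  show "fps_nth f n = fps_nth g n"
    using assms[of "Suc n", unfolded fps_X_power_dvd_iff] by simp
qed

lemma dvd_diff_sym:
  fixes a b d :: "'a::comm_ring_1"
  assumes "d dvd a - b"
  shows "d dvd b - a"
  using dvd_minus_iff[of d "a - b"] assms by simp

lemma dvd_diff_trans:
  fixes a b c d :: "'a::comm_ring_1"
  assumes "d dvd a - b" "d dvd b - c"
  shows "d dvd a - c"
  using dvd_add[OF assms] by simp

lemma dvd_diff_mult:
  fixes a b c d e :: "'a::comm_ring_1"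
  assumes "e dvd a - b" "e dvd c - d"
  shows "e dvd a * c - b * d"
proof -
  have "a * c - b * d = (a - b) * c + b * (c - d)" by (simp add: algebra_simps)
  with assms show ?thesis by simp
qed

lemma dvd_diff_power:
  fixes a b e :: "'a::comm_ring_1"
  assumes "e dvd a - b"
  shows "e dvd a ^ n - b ^ n"
proof (induction n)
  case (Suc n)
  show ?case unfolding power_Suc by (rule dvd_diff_mult[OF assms Suc.IH])
qed simp

definition euler :: "int fps" where
  "euler = qpoch_inf fps_X fps_X"

definition euler_prod :: "nat \<Rightarrow> int fps" where
  "euler_prod n = (\<Prod>i=1..n. 1 - fps_X ^ i)"

lemma euler_prod_0 [simp]: "euler_prod 0 = 1"
  by (simp add: euler_prod_def)

lemma euler_prod_Suc: "euler_prod (Suc n) = euler_prod n * (1 - fps_X ^ Suc n)"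
  by (simp add: euler_prod_def)

lemma euler_prod_dvd_diff:
  assumes "m \<le> n"
  shows "fps_X ^ Suc m dvd euler_prod n - euler_prod m"
  using assms
proof (induction n rule: dec_induct)
  case (step n)
  have "euler_prod (Suc n) - euler_prod n = - (fps_X ^ Suc n * euler_prod n)"
    by (simp add: euler_prod_Suc algebra_simps)
  moreover have "fps_X ^ Suc m dvd (fps_X ^ Suc n :: int fps)"
    using step.hyps by (intro le_imp_power_dvd) simp
  ultimately have "fps_X ^ Suc m dvd euler_prod (Suc n) - euler_prod n"
    by (simp only: dvd_minus_iff) (rule dvd_mult2)
  then show ?case using step.IH by (rule dvd_diff_trans)
qed simp

text \<open>Convergence in the X-adic metric means that each coefficient is eventually constant. A
  nonzero \<open>p\<close> excludes the case of \<open>has_prod\<close> in which a factor vanishes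
  and only a tail converges to a nonzero limit.\<close>

lemma fps_nth_prodinf:
  fixes f :: "nat \<Rightarrow> 'a::idom fps"
  assumes "f has_prod p" "p \<noteq> 0"
  shows "\<exists>N. \<forall>n\<ge>N. fps_nth (\<Prod>i\<le>n. f i) k = fps_nth p k"
proof -
  from assms have "raw_has_prod f 0 p"
    by (auto simp: has_prod_def)
  then have "(\<lambda>n. \<Prod>i\<le>n. f i) \<longlonglongrightarrow> p"
    by (simp add: raw_has_prod_def)
  then show ?thesis
    by (auto simp: tendsto_fps_iff eventually_at_top_linorder)
qed

lemma euler_prod_dvd_euler: "fps_X ^ Suc m dvd euler - euler_prod m"
  unfolding fps_X_power_dvd_iff
proof (intro allI impI)
  fix k assume k: "k < Suc m"
  have "(\<lambda>n. 1 - fps_X * fps_X ^ n) has_prod euler"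
    unfolding euler_def by (rule has_prod_qpoch_inf) auto
  moreover have "euler \<noteq> 0"
    using qpoch_inf_nth_0[of "fps_X :: int fps" fps_X] by (auto simp: euler_def)
  ultimately obtain N where N:
    "\<And>n. n \<ge> N \<Longrightarrow> fps_nth (\<Prod>i\<le>n. 1 - fps_X * fps_X ^ i) k = fps_nth euler k"
    using fps_nth_prodinf by blast
  have eq: "(\<Prod>i\<le>n. 1 - fps_X * fps_X ^ i) = euler_prod (Suc n)" for n
    by (induction n) (simp_all add: euler_prod_Suc)
  have "fps_nth (euler_prod (Suc (max N m))) k = fps_nth euler k"
    using N[of "max N m"] by (simp add: eq)
  moreover have "fps_X ^ Suc m dvd euler_prod (Suc (max N m)) - euler_prod m"
    by (rule euler_prod_dvd_diff) simp
  then have "fps_nth (euler_prod (Suc (max N m))) k = fps_nth (euler_prod m) k"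
    using k unfolding fps_X_power_dvd_iff by simp
  ultimately show "fps_nth (euler - euler_prod m) k = 0"
    by simp
qed

lemma euler_nth_0 [simp]: "fps_nth euler 0 = 1"
  unfolding euler_def by (rule qpoch_inf_nth_0) auto

lemma dilate3_dvd:
  assumes "fps_X ^ m dvd (f :: 'a::idom fps)"
  shows "fps_X ^ (3 * m) dvd dilate3 f"
  using assms by (auto simp: fps_X_power_dvd_iff dilate3_nth)

text \<open>Both sides are approximated by the same dilated finite products; this makes the second
  factor of \<open>p33_denom\<close> accessible to trisection.\<close>

lemma dilate3_euler: "dilate3 euler = qpoch_inf (fps_X ^ 3) (fps_X ^ 3)"
proof (rule fps_ext)
  fix k
  have "(\<lambda>n. 1 - fps_X ^ 3 * (fps_X ^ 3) ^ n) has_prod qpoch_inf (fps_X ^ 3) (fps_X ^ 3 :: int fps)"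
    by (rule has_prod_qpoch_inf) auto
  moreover have "qpoch_inf (fps_X ^ 3) (fps_X ^ 3 :: int fps) \<noteq> 0"
    using qpoch_inf_nth_0[of "fps_X ^ 3 :: int fps" "fps_X ^ 3"] by auto
  ultimately obtain N where N:
    "\<And>n. n \<ge> N \<Longrightarrow> fps_nth (\<Prod>i\<le>n. 1 - fps_X ^ 3 * (fps_X ^ 3) ^ i) k
       = fps_nth (qpoch_inf (fps_X ^ 3) (fps_X ^ 3 :: int fps)) k"
    using fps_nth_prodinf by blast
  have eq: "(\<Prod>i\<le>n. 1 - fps_X ^ 3 * (fps_X ^ 3) ^ i) = dilate3 (euler_prod (Suc n))" for n
    by (induction n) (simp_all add: euler_prod_Suc dilate3_mult dilate3_power)
  have "fps_X ^ (3 * Suc (Suc (max N k))) dvd dilate3 (euler - euler_prod (Suc (max N k)))"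
    by (intro dilate3_dvd euler_prod_dvd_euler)
  then have "fps_nth (dilate3 euler) k = fps_nth (dilate3 (euler_prod (Suc (max N k)))) k"
    by (auto simp: fps_X_power_dvd_iff)
  with N[of "max N k"] show "fps_nth (dilate3 euler) k = fps_nth (qpoch_inf (fps_X ^ 3) (fps_X ^ 3)) k"
    by (simp add: eq)
qed

lemma trisect_dvd:
  assumes "fps_X ^ (3 * m) dvd f - (g :: 'a::comm_ring_1 fps)" "r < 3"
  shows "fps_X ^ m dvd trisect r f - trisect r g"
  using assms by (auto simp: fps_X_power_dvd_iff)

text \<open>The norm is a polynomial in the sections, and coefficient \<open>k\<close> of a section
  is coefficient \<open>3k + r\<close> of the series; hence the precision drops from
  \<open>3m\<close> to \<open>m\<close>.\<close>

lemma trinorm_dvd: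
  assumes "fps_X ^ (3 * m) dvd f - (g :: 'a::comm_ring_1 fps)"
  shows "fps_X ^ m dvd trinorm f - trinorm g"
proof -
  have *: "fps_X ^ m dvd trisect r f - trisect r g" if "r < 3" for r
    using trisect_dvd[OF assms that] .
  have add: "e dvd a + b - (c + d)" if "e dvd a - c" "e dvd b - d" for a b c d e :: "'a fps"
    using dvd_add[OF that] by (simp add: algebra_simps)
  have sub: "e dvd a - b - (c - d)" if "e dvd a - c" "e dvd b - d" for a b c d e :: "'a fps"
    using dvd_diff[OF that] by (simp add: algebra_simps)
  show ?thesis
    unfolding trinorm_def by (intro add sub dvd_diff_mult dvd_diff_power *) auto
qed

text \<open>Factors with exponent prime to 3 equal their norm, while the exponents \<open>3i\<close>
  contribute \<open>(1 - X^i)^3\<close>. The dilated product supplies the missing factors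
  \<open>1 - X^(3i)\<close>.\<close>

lemma trinorm_euler_prod:
  "trinorm (euler_prod (3 * m)) * dilate3 (euler_prod m) = euler_prod (3 * m) * euler_prod m ^ 3"
proof (induction m)
  case (Suc m)
  have N: "trinorm (euler_prod (3 * Suc m)) = trinorm (euler_prod (3 * m)) *
      (1 - fps_X ^ (3 * m + 1)) * (1 - fps_X ^ (3 * m + 2)) * (1 - fps_X ^ Suc m) ^ 3"
  proof -
    have "\<not> 3 dvd Suc (3 * m)" "\<not> 3 dvd Suc (Suc (3 * m))" by presburger+
    moreover have "euler_prod (3 * Suc m) = euler_prod (3 * m) * (1 - fps_X ^ (3 * m + 1)) *
        (1 - fps_X ^ (3 * m + 2)) * (1 - fps_X ^ (3 * Suc m))"
      by (simp add: euler_prod_Suc numeral_3_eq_3 del: power_Suc)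
    ultimately show ?thesis
      by (simp add: trinorm_mult trinorm_one_minus_X_power del: power_Suc mult_Suc_right)
  qed
  have D: "dilate3 (euler_prod (Suc m)) = dilate3 (euler_prod m) * (1 - fps_X ^ (3 * m + 3))"
    by (simp only: euler_prod_Suc dilate3_mult dilate3_power dilate3_hom flip: power_mult) simp
  have E3: "euler_prod (3 * Suc m) = euler_prod (3 * m) *
      (1 - fps_X ^ (3 * m + 1)) * (1 - fps_X ^ (3 * m + 2)) * (1 - fps_X ^ (3 * m + 3))"
    by (simp add: euler_prod_Suc numeral_3_eq_3 del: power_Suc)
  have "trinorm (euler_prod (3 * Suc m)) * dilate3 (euler_prod (Suc m)) =
     (trinorm (euler_prod (3 * m)) * dilate3 (euler_prod m)) *
      ((1 - fps_X ^ (3 * m + 1)) * (1 - fps_X ^ (3 * m + 2)) * (1 - fps_X ^ Suc m) ^ 3 *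
       (1 - fps_X ^ (3 * m + 3)))"
    unfolding N D by (simp only: mult_ac)
  also have "\<dots> = euler_prod (3 * Suc m) * euler_prod (Suc m) ^ 3"
    unfolding Suc E3 euler_prod_Suc[of m] by (simp only: mult_ac power_mult_distrib)
  finally show ?case .
qed simp

lemma trinorm_euler: "trinorm euler * dilate3 euler = euler ^ 4"
proof (rule fps_eqI_X_power_dvd)
  fix m
  have e3: "fps_X ^ (3 * m) dvd euler - euler_prod (3 * m)"
    by (rule dvd_trans[OF _ euler_prod_dvd_euler]) (simp add: le_imp_power_dvd)
  have e1: "fps_X ^ m dvd euler - euler_prod m"
    by (rule dvd_trans[OF _ euler_prod_dvd_euler]) (simp add: le_imp_power_dvd)
  have e1': "fps_X ^ m dvd euler - euler_prod (3 * m)"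
    by (rule dvd_trans[OF _ e3]) (simp add: le_imp_power_dvd)
  have "fps_X ^ m dvd trinorm euler * dilate3 euler
      - trinorm (euler_prod (3 * m)) * dilate3 (euler_prod m)"
  proof (intro dvd_diff_mult trinorm_dvd e3)
    have "fps_X ^ m dvd (fps_X ^ (3 * m) :: int fps)" by (simp add: le_imp_power_dvd)
    also have "fps_X ^ (3 * m) dvd dilate3 (euler - euler_prod m)"
      by (intro dilate3_dvd e1)
    finally show "fps_X ^ m dvd dilate3 euler - dilate3 (euler_prod m)" by simp
  qed
  moreover have "fps_X ^ m dvd euler * euler ^ 3 - euler_prod (3 * m) * euler_prod m ^ 3"
    by (intro dvd_diff_mult dvd_diff_power e1 e1')
  then have "fps_X ^ m dvd euler_prod (3 * m) * euler_prod m ^ 3 - euler * euler ^ 3"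
    by (rule dvd_diff_sym)
  ultimately have "fps_X ^ m dvd trinorm euler * dilate3 euler - euler * euler ^ 3"
    unfolding trinorm_euler_prod by (rule dvd_diff_trans)
  also have "euler * euler ^ 3 = euler ^ 4"
    by (simp flip: power_Suc)
  finally show "fps_X ^ m dvd trinorm euler * dilate3 euler - euler ^ 4" .
qed

subsection \<open>The q-binomial theorem and Jacobi's identity\<close>

text \<open>Gaussian binomial coefficients. The q-Pascal rule avoids division, so \<open>q\<close>
  may be any ring element, in particular a constant polynomial over power series.\<close>

fun qbinom :: "'a::comm_ring_1 \<Rightarrow> nat \<Rightarrow> nat \<Rightarrow> 'a" where
  "qbinom q n 0 = 1"
| "qbinom q 0 (Suc k) = 0"
| "qbinom q (Suc n) (Suc k) = qbinom q n k + q ^ Suc k * qbinom q n (Suc k)"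

lemma qbinom_eq_0: "n < k \<Longrightarrow> qbinom q n k = 0"
  by (induction q n k rule: qbinom.induct) auto

text \<open>Splitting off the factor \<open>i = 0\<close> leaves the product of length
  \<open>n\<close> at \<open>x * q\<close>, which is why \<open>x\<close> is generalized; the
  q-Pascal rule then joins the two sums.\<close>

lemma qbinomial_theorem:
  fixes x y q :: "'a::comm_ring_1"
  shows "(\<Prod>i<n. y + x * q ^ i) = (\<Sum>k\<le>n. qbinom q n k * q ^ (k choose 2) * x ^ k * y ^ (n - k))"
proof (induction n arbitrary: x)
  case (Suc n)
  have choose0: "0 choose 2 = (0::nat)" by simp
  let ?c = "\<lambda>k. qbinom q n k * q ^ (k choose 2) * (x * q) ^ k * y ^ (n - k)"
  have "(\<Prod>i<Suc n. y + x * q ^ i) = (y + x) * (\<Prod>i<n. y + (x * q) * q ^ i)"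
    by (subst prod.lessThan_Suc_shift) (simp add: mult_ac)
  also have "\<dots> = y * (\<Sum>k\<le>n. ?c k) + x * (\<Sum>k\<le>n. ?c k)"
    by (simp only: Suc.IH ring_distribs)
  also have "y * (\<Sum>k\<le>n. ?c k) = y * (\<Sum>k\<le>Suc n. ?c k)"
    by (simp add: qbinom_eq_0)
  also have "\<dots> = y ^ Suc n + (\<Sum>k\<le>n. y * ?c (Suc k))"
    by (subst sum.atMost_Suc_shift)
       (simp add: ring_distribs sum_distrib_left choose0 del: qbinom.simps(3))
  also have "(\<Sum>k\<le>n. y * ?c (Suc k)) = (\<Sum>k\<le>n. q ^ Suc k * qbinom q n (Suc k) *
      q ^ (Suc k choose 2) * x ^ Suc k * y ^ (n - k))"
  proof (rule sum.cong)
    fix k assume "k \<in> {..n}"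
    show "y * ?c (Suc k) = q ^ Suc k * qbinom q n (Suc k) *
      q ^ (Suc k choose 2) * x ^ Suc k * y ^ (n - k)"
    proof (cases "k = n")
      case False
      with \<open>k \<in> {..n}\<close> have "n - k = Suc (n - Suc k)" by simp
      then have "y ^ (n - k) = y * y ^ (n - Suc k)" by simp
      then show ?thesis by (simp only: power_mult_distrib mult_ac)
    qed (simp add: qbinom_eq_0)
  qed simp
  also have "x * (\<Sum>k\<le>n. ?c k) = (\<Sum>k\<le>n. qbinom q n k *
      q ^ (Suc k choose 2) * x ^ Suc k * y ^ (n - k))"
    by (auto simp: sum_distrib_left numeral_2_eq_2 power_add power_mult_distrib mult_ac intro!: sum.cong)
  also have "y ^ Suc n + (\<Sum>k\<le>n. q ^ Suc k * qbinom q n (Suc k) *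
      q ^ (Suc k choose 2) * x ^ Suc k * y ^ (n - k)) + \<dots> =
      y ^ Suc n + (\<Sum>k\<le>n. qbinom q (Suc n) (Suc k) *
      q ^ (Suc k choose 2) * x ^ Suc k * y ^ (n - k))"
    by (simp add: ring_distribs sum.distrib)
  also have "\<dots> = (\<Sum>k\<le>Suc n. qbinom q (Suc n) k * q ^ (k choose 2) * x ^ k * y ^ (Suc n - k))"
    by (subst sum.atMost_Suc_shift) (simp add: choose0)
  finally show ?case .
qed (simp add: numeral_2_eq_2)

text \<open>The q-factorial quotient formula without division; its induction rests on
  \<open>1 - X^(n+1) = (1 - X^(k+1)) + X^(k+1) (1 - X^(n-k))\<close>.\<close>

lemma qbinom_euler_prod:
  "k \<le> n \<Longrightarrow> qbinom fps_X n k * (euler_prod k * euler_prod (n - k)) = euler_prod n"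
proof (induction "fps_X :: int fps" n k rule: qbinom.induct)
  case (3 n k)
  show ?case
  proof (cases "k = n")
    case True
    with 3 show ?thesis by (simp add: qbinom_eq_0 euler_prod_Suc flip: mult.assoc)
  next
    case False
    with 3 have k: "Suc k \<le> n" by simp
    then have nk: "n - k = Suc (n - Suc k)" by simp
    have IH1: "qbinom fps_X n k * (euler_prod k * euler_prod (n - k)) = euler_prod n"
      using 3 by simp
    have IH2: "qbinom fps_X n (Suc k) * (euler_prod (Suc k) * euler_prod (n - Suc k)) = euler_prod n"
      using 3 k by simp
    have "qbinom fps_X (Suc n) (Suc k) * (euler_prod (Suc k) * euler_prod (Suc n - Suc k)) =
      qbinom fps_X n k * (euler_prod k * euler_prod (n - k)) * (1 - fps_X ^ Suc k) +
      fps_X ^ Suc k * (qbinom fps_X n (Suc k) * (euler_prod (Suc k) * euler_prod (n - Suc k)))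
        * (1 - fps_X ^ Suc (n - Suc k))"
      by (simp add: nk euler_prod_Suc ring_distribs mult_ac del: power_Suc)
    also have "\<dots> = euler_prod n * (1 - fps_X ^ Suc k * fps_X ^ Suc (n - Suc k))"
      unfolding IH1 IH2 by (simp add: algebra_simps del: power_Suc)
    also have "fps_X ^ Suc k * fps_X ^ Suc (n - Suc k) = (fps_X ^ Suc n :: int fps)"
      using k by (simp flip: power_add power_Suc)
    finally show ?thesis by (simp add: euler_prod_Suc)
  qed
qed simp_all

definition euler_inv :: "int fps" where
  "euler_inv = fps_right_inverse euler 1"

lemma euler_mult_inv [simp]: "euler * euler_inv = 1"
  unfolding euler_inv_def by (rule fps_right_inverse) simp

lemma X_power_dvd_euler_multD:
  assumes "fps_X ^ m dvd euler * f"
  shows "fps_X ^ m dvd f"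
proof -
  have "fps_X ^ m dvd euler_inv * (euler * f)" using assms by (rule dvd_mult)
  also have "euler_inv * (euler * f) = (euler * euler_inv) * f" by (simp only: mult_ac)
  finally show ?thesis by simp
qed

text \<open>The finite products of lengths \<open>n\<close>, \<open>k\<close> and
  \<open>n - k\<close> all agree with \<open>euler\<close> modulo \<open>X^(d+1)\<close>, and
  \<open>euler\<close> can be cancelled as a unit; so the Gaussian binomial is close to
  \<open>1/euler\<close>.\<close>

lemma qbinom_euler_dvd:
  assumes "d \<le> k" "d + k \<le> n"
  shows "fps_X ^ Suc d dvd qbinom fps_X n k * euler - 1"
proof -
  have approx: "fps_X ^ Suc d dvd euler_prod j - euler" if "d \<le> j" for j
  proof -
    have "fps_X ^ Suc d dvd (fps_X ^ Suc j :: int fps)"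
      using that by (intro le_imp_power_dvd) simp
    also have "\<dots> dvd euler - euler_prod j" by (rule euler_prod_dvd_euler)
    finally show ?thesis by (rule dvd_diff_sym)
  qed
  have "fps_X ^ Suc d dvd qbinom fps_X n k * (euler_prod k * euler_prod (n - k))
      - qbinom fps_X n k * (euler * euler)"
    using assms by (intro dvd_diff_mult approx) auto
  then have 1: "fps_X ^ Suc d dvd euler_prod n - qbinom fps_X n k * (euler * euler)"
    using assms by (simp add: qbinom_euler_prod)
  have "fps_X ^ Suc d dvd euler_prod n - euler" using assms by (intro approx) simp
  then have "fps_X ^ Suc d dvd euler - euler_prod n" by (rule dvd_diff_sym)
  then have "fps_X ^ Suc d dvd euler - qbinom fps_X n k * (euler * euler)"
    using 1 by (rule dvd_diff_trans)
  also have "euler - qbinom fps_X n k * (euler * euler) = euler * (1 - qbinom fps_X n k * euler)"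
    by (simp add: algebra_simps)
  finally have "fps_X ^ Suc d dvd 1 - qbinom fps_X n k * euler"
    by (rule X_power_dvd_euler_multD)
  then show ?thesis by (rule dvd_diff_sym)
qed

section \<open>Jacobi's identity, finite form and limit\<close>

lemma prod_lessThan_split_at:
  fixes f :: "nat \<Rightarrow> 'a::comm_monoid_mult"
  shows "(\<Prod>i<n + 1 + j. f i) = (\<Prod>i<n. f i) * f n * (\<Prod>i=1..j. f (n + i))"
  by (induction j) (simp_all add: mult_ac)

lemma sum_atMost_split_around:
  fixes f :: "nat \<Rightarrow> 'a::comm_monoid_add"
  shows "(\<Sum>k\<le>2 * n + 1. f k) = (\<Sum>m\<le>n. f (n + 1 + m) + f (n - m))"
proof -
  have "(\<Sum>k\<le>n + 1 + j. f k) = (\<Sum>k\<le>n. f k) + (\<Sum>m\<le>j. f (n + 1 + m))" for j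
    by (induction j) (simp_all add: add_ac)
  from this[of n] have "(\<Sum>k\<le>2 * n + 1. f k) = (\<Sum>k\<le>n. f k) + (\<Sum>m\<le>n. f (n + 1 + m))"
    by (simp add: mult_2)
  moreover have "(\<Sum>k\<le>n. f k) = (\<Sum>m\<le>n. f (n - m))"
    using sum.atLeastAtMost_rev[of f 0 n] by (simp add: atMost_atLeast0)
  ultimately show ?thesis by (simp add: sum.distrib add.commute)
qed

text \<open>Allows the q-binomial theorem to be used in polynomials in \<open>z\<close> over power
  series, where a formal derivative in \<open>z\<close> is available.\<close>

lemma qbinom_const_poly: "qbinom [:q:] n k = [:qbinom q n k:]"
proof (induction q n k rule: qbinom.induct)
  case (3 q n k)
  have "[:q:] ^ j = [:q ^ j:]" for j by (simp add: poly_const_pow)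
  with 3 show ?case by simp
qed (simp_all add: one_pCons)

lemma double_triangular: "2 * (Suc a choose 2) = a * Suc a"
  by (simp add: choose_two)

text \<open>The exponent of \<open>q\<close> at index \<open>k\<close> in the expansion of
  \<open>finite_jacobi\<close> is symmetric under replacing \<open>k\<close> by
  \<open>2n + 1 - k\<close>. Doubling clears the binomial coefficients.\<close>

lemma power_choose_two_exponents:
  fixes m n :: nat
  assumes "m \<le> n"
  shows "((n + 1 + m) choose 2) + n * (n - m) = (Suc n choose 2) + n * n + (Suc m choose 2)"
    and "((n - m) choose 2) + n * (n + 1 + m) = (Suc n choose 2) + n * n + (Suc m choose 2)"
proof -
  obtain d where n: "n = m + d" using assms by (metis le_add_diff_inverse)
  have "2 * ((Suc (n + m) choose 2) + n * d) = 2 * ((Suc n choose 2) + n * n + (Suc m choose 2))"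
    unfolding distrib_left double_triangular by (simp add: n algebra_simps)
  then show "((n + 1 + m) choose 2) + n * (n - m) = (Suc n choose 2) + n * n + (Suc m choose 2)"
    by (simp add: n)
  have "2 * ((d choose 2) + n * (n + 1 + m)) = 2 * ((Suc n choose 2) + n * n + (Suc m choose 2))"
  proof (cases d)
    case 0
    then show ?thesis
      unfolding distrib_left double_triangular by (simp add: n numeral_2_eq_2 algebra_simps)
  next
    case (Suc e)
    show ?thesis
      unfolding Suc distrib_left double_triangular by (simp add: n Suc algebra_simps)
  qed
  then show "((n - m) choose 2) + n * (n + 1 + m) = (Suc n choose 2) + n * n + (Suc m choose 2)"
    by (simp add: n)
qed

lemma pderiv_sum: "pderiv (\<Sum>i\<in>A. f i) = (\<Sum>i\<in>A. pderiv (f i))"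
  by (induction A rule: infinite_finite_induct) (simp_all add: pderiv_add)

text \<open>
  The product of the \<open>q\<^sup>n - z q\<^sup>i\<close> over \<open>i \<le> 2n\<close> vanishes at \<open>z = 1\<close> because of the factor with
  \<open>i = n\<close>. Comparing its derivative there with that of the \<open>q\<close>-binomial expansion gives a
  finite form of Jacobi's identity; the terms \<open>n + 1 + m\<close> and \<open>n - m\<close> carry the same power of \<open>q\<close>.
\<close>

lemma finite_jacobi:
  "(\<Sum>m\<le>n. (-1) ^ m * fps_X ^ (Suc m choose 2) *
      (of_nat (n + 1 + m) * qbinom fps_X (2 * n + 1) (n + 1 + m)
        - of_nat (n - m) * qbinom fps_X (2 * n + 1) (n - m))) = euler_prod n ^ 2"
proof -
  let ?X = "fps_X :: int fps"
  let ?N = "2 * n + 1"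
  let ?K = "(Suc n choose 2) + n * n"
  define c where "c k = (-1) ^ k * qbinom ?X ?N k * ?X ^ ((k choose 2) + n * (?N - k))" for k
  define L where "L = (\<Prod>i<?N. [:?X ^ n, - (?X ^ i):])"
  have "L = (\<Prod>i<?N. [:?X ^ n:] + [:0, -1:] * [:?X:] ^ i)"
    by (simp add: L_def poly_const_pow)
  also have "\<dots> = (\<Sum>k\<le>?N. monom (c k) k)"
    unfolding qbinomial_theorem
  proof (rule sum.cong)
    fix k
    \<comment> \<open>The q-binomial theorem is applied with \<open>x = -z\<close>, where
      \<open>z\<close> is the polynomial variable.\<close>
    have "[:0, -1:] = monom (-1 :: int fps) 1" by (simp add: monom_Suc monom_0)
    then have "[:0, -1:] ^ k = monom ((-1 :: int fps) ^ k) k" by (simp add: monom_power)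
    then show "qbinom [:?X:] ?N k * [:?X:] ^ (k choose 2) * [:0, -1:] ^ k * [:?X ^ n:] ^ (?N - k)
        = monom (c k) k"
      by (simp add: qbinom_const_poly poly_const_pow c_def smult_monom power_add power_mult mult_ac)
  qed simp
  finally have "poly (pderiv L) 1 = (\<Sum>k\<le>?N. of_nat k * c k)"
    by (simp add: pderiv_sum pderiv_monom poly_sum poly_monom del: sum.atMost_Suc)
  moreover have "poly (pderiv L) 1 = - ((-1) ^ n * ?X ^ ?K * euler_prod n ^ 2)"
  proof -
    define A where "A = (\<Prod>i<n. [:?X ^ n, - (?X ^ i):]) * (\<Prod>j=1..n. [:?X ^ n, - (?X ^ (n + j)):])"
    have N: "2 * n + 1 = n + 1 + n" by simp
    \<comment> \<open>The isolated factor is \<open>X^n (1 - z)\<close>, so in the product rule at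
      \<open>z = 1\<close> only its derivative \<open>-X^n\<close> survives.\<close>
    have "L = A * [:?X ^ n, - (?X ^ n):]"
      using prod_lessThan_split_at[of "\<lambda>i. [:?X ^ n, - (?X ^ i):]" n n]
      unfolding L_def A_def N by (simp only: mult_ac)
    then have "poly (pderiv L) 1 = - (poly A 1 * ?X ^ n)"
      by (simp add: pderiv_mult pderiv_pCons del: mult_pCons_left mult_pCons_right)
    moreover have "poly A 1 = ((-1) ^ n * ?X ^ (n choose 2) * euler_prod n) * (?X ^ (n * n) * euler_prod n)"
    proof -
      have "(\<Prod>i<n. ?X ^ n - ?X ^ i) = (\<Prod>i<n. ?X ^ i * (- (1 - ?X ^ (n - i))))"
      proof (rule prod.cong)
        fix i assume "i \<in> {..<n}"
        then have "?X ^ n = ?X ^ i * ?X ^ (n - i)" by (simp flip: power_add)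
        then show "?X ^ n - ?X ^ i = ?X ^ i * (- (1 - ?X ^ (n - i)))"
          by (simp only: minus_diff_eq right_diff_distrib mult_1_right)
      qed simp
      also have "\<dots> = ?X ^ (\<Sum>i<n. i) * ((-1) ^ n * (\<Prod>i<n. 1 - ?X ^ (n - i)))"
        by (simp only: prod.distrib power_sum prod_uminus card_lessThan)
      also have "(\<Sum>i<n. i) = n choose 2"
        by (induction n) (simp_all add: numeral_2_eq_2)
      also have "(\<Prod>i<n. 1 - ?X ^ (n - i)) = euler_prod n"
        unfolding euler_prod_def
        by (rule prod.reindex_bij_witness[of _ "\<lambda>i. n - i" "\<lambda>i. n - i"]) auto
      finally have 1: "(\<Prod>i<n. ?X ^ n - ?X ^ i) = (-1) ^ n * ?X ^ (n choose 2) * euler_prod n"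
        by (simp only: mult_ac)
      have "(\<Prod>j=1..n. ?X ^ n - ?X ^ (n + j)) = (\<Prod>j=1..n. ?X ^ n * (1 - ?X ^ j))"
        by (intro prod.cong) (auto simp: algebra_simps power_add)
      also have "\<dots> = ?X ^ (n * n) * euler_prod n"
        by (simp add: prod.distrib euler_prod_def power_mult)
      finally show ?thesis using 1 by (simp add: A_def poly_prod)
    qed
    ultimately have "poly (pderiv L) 1 =
        - ((-1) ^ n * (?X ^ (n choose 2) * ?X ^ (n * n) * ?X ^ n) * (euler_prod n * euler_prod n))"
      by (simp only: mult_ac)
    also have "?X ^ (n choose 2) * ?X ^ (n * n) * ?X ^ n = ?X ^ ?K"
      by (simp add: numeral_2_eq_2 flip: power_add)
    finally show ?thesis by (simp only: power2_eq_square)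
  qed
  ultimately have "- ((-1) ^ n * ?X ^ ?K * euler_prod n ^ 2) = (\<Sum>k\<le>?N. of_nat k * c k)"
    by simp
  also have "\<dots> = (\<Sum>m\<le>n. of_nat (n + 1 + m) * c (n + 1 + m) + of_nat (n - m) * c (n - m))"
    by (rule sum_atMost_split_around)
  also have "\<dots> = - ((-1) ^ n * ?X ^ ?K * (\<Sum>m\<le>n. (-1) ^ m * ?X ^ (Suc m choose 2) *
      (of_nat (n + 1 + m) * qbinom ?X ?N (n + 1 + m) - of_nat (n - m) * qbinom ?X ?N (n - m))))"
    unfolding sum_distrib_left sum_negf[symmetric]
  proof (rule sum.cong)
    fix m assume "m \<in> {..n}"
    then have m: "m \<le> n" by simp
    have "?N - (n + 1 + m) = n - m" "?N - (n - m) = n + 1 + m" using m by auto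
    then have e: "((n + 1 + m) choose 2) + n * (?N - (n + 1 + m)) = ?K + (Suc m choose 2)"
      "((n - m) choose 2) + n * (?N - (n - m)) = ?K + (Suc m choose 2)"
      using power_choose_two_exponents[OF m] by presburger+
    obtain d where d: "n = m + d" using m by (metis le_add_diff_inverse)
    \<comment> \<open>The signs at \<open>n + 1 + m\<close> and \<open>n - m\<close> are opposite,
      which turns each pair of terms into a difference.\<close>
    have s: "(-1) ^ (n - m) = ((-1) ^ n * (-1) ^ m :: int fps)"
      by (cases "even m"; cases "even d") (simp_all add: d)
    have gen: "a * (u * -1 * v * q * (k * x)) + b * (u * v * q' * (k * x)) =
        - (u * k * (v * x * (a * q - b * q')))" for a b u v q q' k x :: "int fps"
      by (simp add: algebra_simps)
    show "of_nat (n + 1 + m) * c (n + 1 + m) + of_nat (n - m) * c (n - m) =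
      - ((-1) ^ n * ?X ^ ?K * ((-1) ^ m * ?X ^ (Suc m choose 2) *
      (of_nat (n + 1 + m) * qbinom ?X ?N (n + 1 + m) - of_nat (n - m) * qbinom ?X ?N (n - m))))"
      unfolding c_def e s power_add power_one_right by (rule gen)
  qed simp
  finally show ?thesis by simp
qed

definition jacobi_sum :: "nat \<Rightarrow> int fps" where
  "jacobi_sum n = (\<Sum>m\<le>n. of_int ((-1) ^ m * (2 * int m + 1)) * fps_X ^ (Suc m choose 2))"

text \<open>Multiply \<open>finite_jacobi\<close> by \<open>euler\<close>. Each Gaussian binomial
  times \<open>euler\<close> is 1 modulo \<open>X^(n-m+1)\<close>, the triangular exponent supplies
  the remaining \<open>X^m\<close>, and the weights leave
  \<open>(n + 1 + m) - (n - m) = 2m + 1\<close>.\<close>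

lemma euler_cubed_dvd_diff: "fps_X ^ Suc n dvd euler ^ 3 - jacobi_sum n"
proof -
  let ?X = "fps_X :: int fps"
  let ?N = "2 * n + 1"
  let ?q = "\<lambda>k. qbinom ?X ?N k"
  have "fps_X ^ Suc n dvd euler - euler_prod n" by (rule euler_prod_dvd_euler)
  then have "fps_X ^ Suc n dvd euler ^ 2 * euler - euler_prod n ^ 2 * euler"
    by (intro dvd_diff_mult dvd_diff_power) auto
  moreover have "fps_X ^ Suc n dvd euler_prod n ^ 2 * euler - jacobi_sum n"
  proof -
    have "euler_prod n ^ 2 * euler - jacobi_sum n = (\<Sum>m\<le>n. (-1) ^ m * ?X ^ (Suc m choose 2) *
      (of_nat (n + 1 + m) * (?q (n + 1 + m) * euler - 1) - of_nat (n - m) * (?q (n - m) * euler - 1)))"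
      unfolding finite_jacobi[symmetric] jacobi_sum_def sum_distrib_right sum_subtractf[symmetric]
    proof (rule sum.cong)
      fix m assume "m \<in> {..n}"
      then have c: "of_int ((-1) ^ m * (2 * int m + 1)) =
          (-1) ^ m * (of_nat (n + 1 + m) - of_nat (n - m) :: int fps)"
        by (simp add: of_nat_diff)
      have "s * x * (a * q1 - b * q2) * e - s * (a - b) * x = s * x * (a * (q1 * e - 1) - b * (q2 * e - 1))"
        for s x a b q1 q2 e :: "int fps"
        by (simp add: algebra_simps)
      then show "(-1) ^ m * ?X ^ (Suc m choose 2) * (of_nat (n + 1 + m) * ?q (n + 1 + m)
          - of_nat (n - m) * ?q (n - m)) * euler
          - of_int ((-1) ^ m * (2 * int m + 1)) * ?X ^ (Suc m choose 2) =
        (-1) ^ m * ?X ^ (Suc m choose 2) *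
      (of_nat (n + 1 + m) * (?q (n + 1 + m) * euler - 1) - of_nat (n - m) * (?q (n - m) * euler - 1))"
        unfolding c .
    qed simp
    also have "fps_X ^ Suc n dvd \<dots>"
    proof (rule dvd_sum)
      fix m assume "m \<in> {..n}"
      then have m: "m \<le> n" by simp
      have "m \<le> Suc m choose 2" by (simp add: numeral_2_eq_2)
      with m have "fps_X ^ Suc n dvd (?X ^ ((Suc m choose 2) + Suc (n - m)))"
        by (intro le_imp_power_dvd) simp
      moreover have "fps_X ^ Suc (n - m) dvd of_nat (n + 1 + m) * (?q (n + 1 + m) * euler - 1)
          - of_nat (n - m) * (?q (n - m) * euler - 1)"
        using m by (intro dvd_diff dvd_mult qbinom_euler_dvd) auto
      ultimately show "fps_X ^ Suc n dvd (-1) ^ m * ?X ^ (Suc m choose 2) *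
      (of_nat (n + 1 + m) * (?q (n + 1 + m) * euler - 1) - of_nat (n - m) * (?q (n - m) * euler - 1))"
        unfolding power_add mult.assoc by (meson dvd_mult dvd_trans mult_dvd_mono dvd_refl)
    qed
    finally show ?thesis .
  qed
  ultimately have "fps_X ^ Suc n dvd euler ^ 2 * euler - jacobi_sum n"
    by (rule dvd_diff_trans)
  also have "euler ^ 2 * euler = euler ^ 3" by (simp add: power2_eq_square power3_eq_cube)
  finally show ?thesis .
qed

section \<open>Trisection of the cube of the Euler product\<close>

lemma sum_atMost_triple:
  fixes f :: "nat \<Rightarrow> 'a::comm_monoid_add"
  shows "(\<Sum>m\<le>3 * n + 2. f m) = (\<Sum>j\<le>n. f (3 * j) + f (3 * j + 1) + f (3 * j + 2))"
proof (induction n)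
  case (Suc n)
  have "3 * Suc n + 2 = Suc (Suc (Suc (3 * n + 2)))" by simp
  with Suc show ?case by (simp only: sum.atMost_Suc) (simp add: add_ac eval_nat_numeral)
qed (simp add: numeral_2_eq_2)

text \<open>No triangular number is 2 modulo 3, and those that are 1 modulo 3 have the form
  \<open>9T + 1\<close> with \<open>T\<close> triangular.\<close>

lemma triangular_mult_3:
  "Suc (3 * j) choose 2 = 3 * (3 * (Suc j choose 2) - j)"
  "Suc (3 * j + 1) choose 2 = 3 * (3 * (Suc j choose 2)) + 1"
  "Suc (3 * j + 2) choose 2 = 3 * (3 * (Suc j choose 2) + j + 1)"
proof -
  have "2 * (Suc (3 * j) choose 2) + 6 * j = 9 * (2 * (Suc j choose 2))"
    unfolding double_triangular by (simp add: algebra_simps)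
  then show "Suc (3 * j) choose 2 = 3 * (3 * (Suc j choose 2) - j)"
    by presburger
  have "2 * (Suc (3 * j + 1) choose 2) = 9 * (2 * (Suc j choose 2)) + 2"
    unfolding double_triangular by (simp add: algebra_simps)
  then show "Suc (3 * j + 1) choose 2 = 3 * (3 * (Suc j choose 2)) + 1"
    by presburger
  have "2 * (Suc (3 * j + 2) choose 2) = 9 * (2 * (Suc j choose 2)) + 6 * j + 6"
    unfolding double_triangular by (simp add: algebra_simps)
  then show "Suc (3 * j + 2) choose 2 = 3 * (3 * (Suc j choose 2) + j + 1)"
    by presburger
qed

text \<open>In both sections only \<open>m = 3j + 1\<close> could contribute, with weight
  \<open>2m + 1 = 3 (2j + 1)\<close> and sign opposite to that of \<open>j\<close>: this yields the
  factor -3 and reproduces the series in \<open>q^3\<close>. The bound \<open>3n + 2\<close>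
  completes the last block of three.\<close>

lemma trisect_jacobi_sum:
  "trisect (Suc 0) (jacobi_sum (3 * n + 2)) = - 3 * dilate3 (jacobi_sum n)"
  "trisect 2 (jacobi_sum (3 * n + 2)) = 0"
proof -
  let ?t = "\<lambda>r m. trisect r (of_int ((-1) ^ m * (2 * int m + 1)) * fps_X ^ (Suc m choose 2) :: int fps)"
  have m: "3 * a mod 3 = (0::nat)" "(3 * a + 1) mod 3 = Suc 0" "(3 * a + 1) div 3 = a" for a
    by presburger+
  have t: "?t r (3 * j) = 0" "?t r (3 * j + 2) = 0" if "0 < r" "r < 3" for r j
    using that unfolding triangular_mult_3 trisect_const_mult by (simp_all add: trisect_X_power m)
  have t1: "?t (Suc 0) (3 * j + 1) = - 3 * (of_int ((-1) ^ j * (2 * int j + 1)) * dilate3 (fps_X ^ (Suc j choose 2)))" for j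
  proof -
    have "(-1) ^ (3 * j + 1) * (2 * int (3 * j + 1) + 1) = - (3 * ((-1) ^ j * (2 * int j + 1)))"
      by (cases "even j") simp_all
    moreover have "trisect (Suc 0) (fps_X ^ (Suc (3 * j + 1) choose 2)) =
        (fps_X ^ (3 * (Suc j choose 2)) :: int fps)"
      unfolding triangular_mult_3 by (subst trisect_X_power) (simp_all only: m, simp_all)
    ultimately show ?thesis
      unfolding trisect_const_mult by (simp only: dilate3_power dilate3_hom power_mult) simp
  qed
  have lt: "Suc 0 < 3" and lt2: "2 < (3::nat)" by simp_all
  have t2: "?t 2 (3 * j + 1) = 0" for j
    unfolding triangular_mult_3 trisect_const_mult
    by (subst trisect_X_power) (simp_all only: m, simp_all)
  have d: "dilate3 (of_int a :: int fps) = of_int a" for a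
    by (simp flip: fps_of_int)
  show "trisect (Suc 0) (jacobi_sum (3 * n + 2)) = - 3 * dilate3 (jacobi_sum n)"
    unfolding jacobi_sum_def trisect_sum sum_atMost_triple fps_compose_sum_distrib sum_distrib_left
    by (intro sum.cong refl)
       (simp only: trisect_add t[OF zero_less_Suc lt] t1 dilate3_mult d add_0_left add_0_right)
  show "trisect 2 (jacobi_sum (3 * n + 2)) = 0"
    unfolding jacobi_sum_def trisect_sum sum_atMost_triple
    by (intro sum.neutral ballI) (simp only: trisect_add t[OF zero_less_numeral lt2] t2 add_0_left)
qed

lemma trisect_euler_cubed:
  "trisect (Suc 0) (euler ^ 3) = - 3 * dilate3 (euler ^ 3)"
  "trisect 2 (euler ^ 3) = 0"
proof -
  have a: "fps_X ^ n dvd trisect r (euler ^ 3) - trisect r (jacobi_sum (3 * n + 2))" if "r < 3" for n r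
  proof (rule trisect_dvd[OF _ that])
    have "fps_X ^ (3 * n) dvd (fps_X ^ Suc (3 * n + 2) :: int fps)" by (rule le_imp_power_dvd) simp
    also have "\<dots> dvd euler ^ 3 - jacobi_sum (3 * n + 2)" by (rule euler_cubed_dvd_diff)
    finally show "fps_X ^ (3 * n) dvd euler ^ 3 - jacobi_sum (3 * n + 2)" .
  qed
  show "trisect 2 (euler ^ 3) = 0"
  proof (rule fps_eqI_X_power_dvd)
    fix n
    show "fps_X ^ n dvd trisect 2 (euler ^ 3) - 0"
      using a[of 2 n] unfolding trisect_jacobi_sum by simp
  qed
  show "trisect (Suc 0) (euler ^ 3) = - 3 * dilate3 (euler ^ 3)"
  proof (rule fps_eqI_X_power_dvd)
    fix n
    have "fps_X ^ n dvd (fps_X ^ (3 * Suc n) :: int fps)" by (rule le_imp_power_dvd) simp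
    also have "\<dots> dvd dilate3 (euler ^ 3 - jacobi_sum n)"
      by (intro dilate3_dvd euler_cubed_dvd_diff)
    finally have "fps_X ^ n dvd - 3 * dilate3 (jacobi_sum n) - - 3 * dilate3 (euler ^ 3)"
      using dvd_mult[of _ _ 3] by (fastforce simp: algebra_simps)
    moreover have "fps_X ^ n dvd trisect (Suc 0) (euler ^ 3) - - 3 * dilate3 (jacobi_sum n)"
      using a[of "Suc 0" n] unfolding trisect_jacobi_sum by simp
    ultimately show "fps_X ^ n dvd trisect (Suc 0) (euler ^ 3) - - 3 * dilate3 (euler ^ 3)"
      using dvd_diff_trans by blast
  qed
qed

subsection \<open>The modular equation of level 9\<close>

abbreviation euler3 :: "int fps" where "euler3 \<equiv> dilate3 euler"
abbreviation euler9 :: "int fps" where "euler9 \<equiv> dilate3 euler3"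

text \<open>
  With \<open>E\<^sub>k = (q\<^sup>k;q\<^sup>k)\<^sub>\<infinity>\<close>, the series \<open>haupt3 = q E\<^sub>3\<^sup>1\<^sup>2/E\<^sub>1\<^sup>1\<^sup>2\<close> and \<open>haupt9 = q E\<^sub>9\<^sup>3/E\<^sub>1\<^sup>3\<close> are
  Hauptmoduln of level 3 and 9, and \<open>E\<^sub>1\<^sup>3 = E\<^sub>9\<^sup>3 (p(q\<^sup>3) - 3q)\<close> where \<open>p\<close> is \<open>cubic_part\<close>.
\<close>

definition eta_ratio :: "int fps" where
  "eta_ratio = (euler3 * euler_inv) ^ 12"

definition haupt3 :: "int fps" where
  "haupt3 = fps_X * eta_ratio"

definition haupt9 :: "int fps" where
  "haupt9 = fps_X * (euler9 * euler_inv) ^ 3"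

definition cubic_part :: "int fps" where
  "cubic_part = trisect 0 (euler ^ 3) * dilate3 euler_inv ^ 3"

lemma dilate3_euler_inv: "dilate3 euler * dilate3 euler_inv = 1"
  by (simp flip: dilate3_mult)

text \<open>The norm of \<open>euler^3\<close> is computed twice: from \<open>trinorm_euler\<close>,
  and from its sections, of which the last vanishes.\<close>

lemma eta_ratio_mult: "eta_ratio * (cubic_part ^ 3 - 27 * fps_X) = 1"
proof -
  let ?P = "trisect 0 (euler ^ 3)" and ?J = "dilate3 euler_inv"
  have "trinorm (euler ^ 3) * euler3 ^ 3 = (trinorm euler * euler3) ^ 3"
    by (simp add: trinorm_power power_mult_distrib)
  also have "\<dots> = euler ^ 12" by (simp add: trinorm_euler flip: power_mult)
  finally have N: "trinorm (euler ^ 3) * euler3 ^ 3 = euler ^ 12" .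
  have "trinorm (euler ^ 3) = ?P ^ 3 - 27 * fps_X * euler3 ^ 9"
    by (simp add: trinorm_def trisect_euler_cubed dilate3_power power_mult_distrib flip: power_mult)
  moreover have "?P ^ 3 = (cubic_part * euler3 ^ 3) ^ 3"
  proof -
    have "cubic_part * euler3 ^ 3 = ?P * (dilate3 euler * ?J) ^ 3"
      by (simp only: cubic_part_def power_mult_distrib mult_ac)
    then show ?thesis by (simp add: dilate3_euler_inv)
  qed
  ultimately have "trinorm (euler ^ 3) = euler3 ^ 9 * (cubic_part ^ 3 - 27 * fps_X)"
    by (simp add: algebra_simps flip: power_mult)
  with N have "euler3 ^ 12 * (cubic_part ^ 3 - 27 * fps_X) = euler ^ 12"
    by (simp add: mult_ac flip: power_add)
  then have "eta_ratio * (cubic_part ^ 3 - 27 * fps_X) = (euler * euler_inv) ^ 12"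
    by (simp only: eta_ratio_def power_mult_distrib mult_ac)
  then show ?thesis by simp
qed

text \<open>This is the trisection of \<open>euler^3\<close>, divided by
  \<open>euler9^3\<close>.\<close>

lemma haupt9_mult: "haupt9 * (dilate3 cubic_part - 3 * fps_X) = fps_X"
proof -
  have "dilate3 cubic_part = dilate3 (trisect 0 (euler ^ 3)) * dilate3 (dilate3 euler_inv) ^ 3"
    by (simp add: cubic_part_def dilate3_mult dilate3_power)
  moreover have "euler9 * dilate3 (dilate3 euler_inv) = 1"
    by (simp add: dilate3_euler_inv flip: dilate3_mult)
  then have "euler9 ^ 3 * dilate3 (dilate3 euler_inv) ^ 3 = 1"
    by (simp flip: power_mult_distrib)
  ultimately have "euler9 ^ 3 * dilate3 cubic_part = dilate3 (trisect 0 (euler ^ 3))"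
    by (simp only: mult.left_commute[of "euler9 ^ 3"] mult_1_right)
  moreover have "dilate3 (trisect 0 (euler ^ 3)) - fps_X * (3 * euler9 ^ 3) = euler ^ 3"
    using trisect_decomp[of "euler ^ 3"] unfolding trisect_euler_cubed
    by (simp add: dilate3_mult dilate3_power fps_compose_uminus)
  moreover have "euler9 ^ 3 * (dilate3 cubic_part - 3 * fps_X) =
      euler9 ^ 3 * dilate3 cubic_part - fps_X * (3 * euler9 ^ 3)"
    by (simp add: algebra_simps)
  ultimately have "euler9 ^ 3 * (dilate3 cubic_part - 3 * fps_X) = euler ^ 3"
    by (simp only:)
  then have "haupt9 * (dilate3 cubic_part - 3 * fps_X) = fps_X * (euler * euler_inv) ^ 3"
    by (simp only: haupt9_def power_mult_distrib mult_ac)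
  then show ?thesis by simp
qed

lemma dilate3_haupt3: "dilate3 haupt3 = fps_X ^ 3 * dilate3 eta_ratio"
  by (simp add: haupt3_def dilate3_mult)

lemma dilate3_eta_ratio_mult: "dilate3 eta_ratio * (dilate3 cubic_part ^ 3 - 27 * fps_X ^ 3) = 1"
proof -
  have "dilate3 (eta_ratio * (cubic_part ^ 3 - 27 * fps_X)) = 1"
    by (simp add: eta_ratio_mult)
  then show ?thesis by (simp add: dilate3_mult dilate3_power)
qed

text \<open>With \<open>a = p(q^3)\<close>, \<open>haupt9_mult\<close> reads
  \<open>z a = q (1 + 3z)\<close>. Inserting this into \<open>(z a)^3 - 27 (z q)^3\<close> leaves
  \<open>q^3 ((1 + 3z)^3 - 27 z^3)\<close>.\<close>

lemma haupt9_cubed: "haupt9 ^ 3 = dilate3 haupt3 * (1 + 9 * haupt9 + 27 * haupt9 ^ 2)"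
proof -
  let ?z = haupt9 and ?a = "dilate3 cubic_part" and ?e = "dilate3 eta_ratio"
  have za: "?z * ?a = fps_X * (1 + 3 * ?z)"
    using haupt9_mult by (simp add: algebra_simps)
  have "?z ^ 3 = ?z ^ 3 * (?e * (?a ^ 3 - 27 * fps_X ^ 3))"
    by (simp add: dilate3_eta_ratio_mult)
  also have "\<dots> = ?e * ((?z * ?a) ^ 3 - 27 * (?z * fps_X) ^ 3)"
    by (simp add: algebra_simps power_mult_distrib)
  also have "\<dots> = fps_X ^ 3 * ?e * (1 + 9 * ?z + 27 * ?z ^ 2)"
    unfolding za by (simp add: algebra_simps power3_eq_cube power2_eq_square)
  finally show ?thesis by (simp only: dilate3_haupt3)
qed

lemma haupt3_nonzero [simp]: "haupt3 \<noteq> 0"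
proof -
  have "eta_ratio \<noteq> 0" using eta_ratio_mult by auto
  then show ?thesis by (simp add: haupt3_def)
qed

text \<open>The powers of \<open>euler3\<close> cancel in \<open>t t(q^3) = z^4\<close>; comparison
  with \<open>haupt9_cubed\<close> then allows \<open>t(q^3)\<close> to be cancelled.\<close>

lemma haupt3_eq: "haupt3 = haupt9 * (1 + 9 * haupt9 + 27 * haupt9 ^ 2)"
proof -
  have "haupt3 * dilate3 haupt3 = fps_X ^ 4 * (euler9 * euler_inv) ^ 12 * (euler3 * dilate3 euler_inv) ^ 12"
    unfolding haupt3_def eta_ratio_def dilate3_mult dilate3_power dilate3_hom
    by (simp add: power_mult_distrib mult_ac flip: power_Suc)
  also have "\<dots> = haupt9 ^ 4"
    by (simp add: haupt9_def dilate3_euler_inv power_mult_distrib flip: power_mult)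
  finally have "haupt3 * dilate3 haupt3 = haupt9 * haupt9 ^ 3" by (simp flip: power_Suc)
  then have "dilate3 haupt3 * haupt3 = dilate3 haupt3 * (haupt9 * (1 + 9 * haupt9 + 27 * haupt9 ^ 2))"
    unfolding haupt9_cubed by (simp only: mult_ac)
  moreover have "dilate3 haupt3 \<noteq> 0"
  proof
    assume "dilate3 haupt3 = 0"
    then have "trisect 0 (dilate3 haupt3) = 0" by (simp add: fps_eq_iff)
    then show False by (simp add: trisect_dilate3)
  qed
  ultimately show ?thesis using mult_left_cancel[THEN iffD1] by blast
qed

text \<open>Rationalizes \<open>z = q / (a - 3q)\<close> by
  \<open>a^3 - 27 q^3 = (a - 3q) (a^2 + 3 a q + 9 q^2)\<close>, whose left side is a series in
  \<open>q^3\<close>.\<close>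

lemma haupt9_trisection:
  "haupt9 = dilate3 (9 * haupt3) + fps_X * dilate3 (eta_ratio * cubic_part ^ 2)
     + fps_X ^ 2 * dilate3 (3 * eta_ratio * cubic_part)"
  unfolding haupt3_def dilate3_mult dilate3_hom dilate3_power
proof -
  let ?z = haupt9 and ?a = "dilate3 cubic_part" and ?e = "dilate3 eta_ratio"
  have "?z = ?z * (?e * (?a ^ 3 - 27 * fps_X ^ 3))"
    by (simp add: dilate3_eta_ratio_mult)
  also have "\<dots> = ?e * (?z * (?a - 3 * fps_X)) * (?a ^ 2 + 3 * ?a * fps_X + 9 * fps_X ^ 2)"
    by (simp add: algebra_simps power3_eq_cube power2_eq_square)
  also have "\<dots> = 9 * (fps_X ^ 3 * ?e) + fps_X * (?e * ?a ^ 2) + fps_X ^ 2 * (3 * ?e * ?a)"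
    unfolding haupt9_mult by (simp add: algebra_simps power3_eq_cube power2_eq_square)
  finally show "?z = 9 * (fps_X ^ 3 * ?e) + fps_X * (?e * ?a ^ 2) + fps_X ^ 2 * (3 * ?e * ?a)" .
qed

lemma trisect_haupt9:
  "trisect 0 haupt9 = 9 * haupt3"
  "trisect (Suc 0) haupt9 = eta_ratio * cubic_part ^ 2"
  "trisect 2 haupt9 = 3 * eta_ratio * cubic_part"
  by (subst haupt9_trisection, simp add: trisect_dilate3 trisect_dilate3_X)+

lemma trisect_haupt9_squared:
  "trisect 0 (haupt9 ^ 2) = 6 * haupt3 + 243 * haupt3 ^ 2"
  "trisect (Suc 0) (haupt9 ^ 2) = 27 * (haupt3 * (eta_ratio * cubic_part ^ 2))"
proof -
  have ep: "eta_ratio * cubic_part ^ 3 = 1 + 27 * haupt3"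
    using eta_ratio_mult by (simp add: haupt3_def algebra_simps)
  have "trisect 0 (haupt9 ^ 2) = 81 * haupt3 ^ 2 + 6 * haupt3 * (eta_ratio * cubic_part ^ 3)"
    unfolding power2_eq_square[of haupt9] trisect_mult trisect_haupt9
    by (simp add: haupt3_def power2_eq_square power3_eq_cube)
  then show "trisect 0 (haupt9 ^ 2) = 6 * haupt3 + 243 * haupt3 ^ 2"
    unfolding ep by (simp add: algebra_simps power2_eq_square)
  show "trisect (Suc 0) (haupt9 ^ 2) = 27 * (haupt3 * (eta_ratio * cubic_part ^ 2))"
    unfolding power2_eq_square[of haupt9] trisect_mult trisect_haupt9
    by (simp add: haupt3_def power2_eq_square)
qed

lemma trisect_0_quadratic:
  "trisect 0 (dilate3 a + dilate3 b * haupt9 + dilate3 c * haupt9 ^ 2) =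
     a + 9 * haupt3 * b + (6 * haupt3 + 243 * haupt3 ^ 2) * c"
  by (simp add: trisect_dilate3_mult trisect_dilate3 trisect_haupt9 trisect_haupt9_squared)

lemma trisect_1_quadratic:
  "trisect (Suc 0) (dilate3 a + dilate3 b * haupt9 + dilate3 c * haupt9 ^ 2) =
     (b + 27 * haupt3 * c) * (eta_ratio * cubic_part ^ 2)"
  by (simp add: trisect_dilate3_mult trisect_dilate3 trisect_haupt9 trisect_haupt9_squared)
    (simp add: algebra_simps)

text \<open>The multiplication table of the basis \<open>1, z, z^2\<close>, with both
  \<open>z^3\<close> and \<open>z^4\<close> reduced by the cubic equation.\<close>

lemma quadratic_mult_mod_cubic:
  fixes z T :: "'a::idom"
  assumes z3: "z ^ 3 = T * (1 + 9 * z + 27 * z ^ 2)"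
  shows "(a0 + a1 * z + a2 * z ^ 2) * (b0 + b1 * z + b2 * z ^ 2) =
    (a0 * b0 + T * (a1 * b2 + a2 * b1) + 27 * T ^ 2 * (a2 * b2)) +
    (a0 * b1 + a1 * b0 + 9 * T * (a1 * b2 + a2 * b1) + (T + 243 * T ^ 2) * (a2 * b2)) * z +
    (a0 * b2 + a1 * b1 + a2 * b0 + 27 * T * (a1 * b2 + a2 * b1) + (9 * T + 729 * T ^ 2) * (a2 * b2))
      * z ^ 2"
proof -
  have "z ^ 4 = z * z ^ 3" by (simp flip: power_Suc)
  also have "\<dots> = T * z + 9 * T * z ^ 2 + 27 * T * z ^ 3"
    by (subst z3) (simp add: algebra_simps power2_eq_square power3_eq_cube)
  finally have z4: "z ^ 4 = T * z + 9 * T * z ^ 2 + 27 * T * z ^ 3" .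
  have "(a0 + a1 * z + a2 * z ^ 2) * (b0 + b1 * z + b2 * z ^ 2) =
    a0 * b0 + (a0 * b1 + a1 * b0) * z + (a0 * b2 + a1 * b1 + a2 * b0) * z ^ 2
     + (a1 * b2 + a2 * b1) * z ^ 3 + (a2 * b2) * z ^ 4"
    by algebra
  then show ?thesis unfolding z4 unfolding z3 by algebra
qed

text \<open>
  Applied with \<open>t = haupt3\<close>, \<open>z = haupt9\<close> and \<open>T = dilate3 haupt3\<close>: every polynomial in \<open>z\<close> is reduced
  to the basis \<open>1, z, z\<^sup>2\<close> over the series in \<open>q\<^sup>3\<close>, on which trisection is known.
\<close>

lemma modular_equation:
  fixes t z T :: "'a::idom"
  assumes z3: "z ^ 3 = T * (1 + 9 * z + 27 * z ^ 2)"
    and t: "t = z * (1 + 9 * z + 27 * z ^ 2)"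
  shows "z * t = (9 * T + 729 * T ^ 2) + (108 * T + 6561 * T ^ 2) * z + (1 + 486 * T + 19683 * T ^ 2) * z ^ 2"
    and "z * t ^ 2 = (T + 2187 * T ^ 2 + 433026 * T ^ 3 + 23914845 * T ^ 4 + 387420489 * T ^ 5) + (27 * T + 28431 * T ^ 2 + 4605822 * T ^ 3 + 229582512 * T ^ 4 + 3486784401 * T ^ 5) * z + (324 * T + 157464 * T ^ 2 + 18600435 * T ^ 3 + 774840978 * T ^ 4 + 10460353203 * T ^ 5) * z ^ 2"
    and "t ^ 3 = (270 * T + 26244 * T ^ 2 + 531441 * T ^ 3) * t ^ 2 + (36 * T + 729 * T ^ 2) * t + T"
proof -
  note mult = quadratic_mult_mod_cubic[OF z3]
  have zmult: "z * (b0 + b1 * z + b2 * z ^ 2) =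
      T * b2 + (b0 + 9 * T * b2) * z + (b1 + 27 * T * b2) * z ^ 2" for b0 b1 b2
    using mult[of 0 1 0] by simp
  have "t = z + 9 * z ^ 2 + 27 * z ^ 3" unfolding t by algebra
  also have "\<dots> = (27 * T) + (1 + 243 * T) * z + (9 + 729 * T) * z ^ 2" unfolding z3 by algebra
  finally have t1: "t = (27 * T) + (1 + 243 * T) * z + (9 + 729 * T) * z ^ 2" .
  have "t * t = (18 * T + 8748 * T ^ 2 + 708588 * T ^ 3 + 14348907 * T ^ 4) + (297 * T + 98415 * T ^ 2 + 6908733 * T ^ 3 + 129140163 * T ^ 4) * z + (1 + 2187 * T + 433026 * T ^ 2 + 23914845 * T ^ 3 + 387420489 * T ^ 4) * z ^ 2"
    by (subst (1 2) t1, subst mult) algebra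
  then have t2: "t ^ 2 = (18 * T + 8748 * T ^ 2 + 708588 * T ^ 3 + 14348907 * T ^ 4) + (297 * T + 98415 * T ^ 2 + 6908733 * T ^ 3 + 129140163 * T ^ 4) * z + (1 + 2187 * T + 433026 * T ^ 2 + 23914845 * T ^ 3 + 387420489 * T ^ 4) * z ^ 2" by (simp only: power2_eq_square)
  have "t * t ^ 2 = (T + 5832 * T ^ 2 + 2854035 * T ^ 3 + 430467210 * T ^ 4 + 27119434230 * T ^ 5 + 753145430616 * T ^ 6 + 7625597484987 * T ^ 7) + (36 * T + 89667 * T ^ 2 + 34543665 * T ^ 3 + 4605999147 * T ^ 4 + 268482398877 * T ^ 5 + 7060738412025 * T ^ 6 + 68630377364883 * T ^ 7) * z + (594 * T + 649539 * T ^ 2 + 175375530 * T ^ 3 + 18983603961 * T ^ 4 + 962352494676 * T ^ 5 + 22876792454961 * T ^ 6 + 205891132094649 * T ^ 7) * z ^ 2"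
    by (subst t1, subst t2, subst mult) algebra
  \<comment> \<open>The coefficients of the cubic for \<open>t\<close> are determined by matching
    the coordinates of \<open>t^3\<close> in \<open>1, z, z^2\<close> with those of
    \<open>t^2\<close>, \<open>t\<close> and 1.\<close>
  also have "\<dots> = (270 * T + 26244 * T ^ 2 + 531441 * T ^ 3) * ((18 * T + 8748 * T ^ 2 + 708588 * T ^ 3 + 14348907 * T ^ 4) + (297 * T + 98415 * T ^ 2 + 6908733 * T ^ 3 + 129140163 * T ^ 4) * z + (1 + 2187 * T + 433026 * T ^ 2 + 23914845 * T ^ 3 + 387420489 * T ^ 4) * z ^ 2) + (36 * T + 729 * T ^ 2) * ((27 * T) + (1 + 243 * T) * z + (9 + 729 * T) * z ^ 2) + T"
    by algebra
  also have "\<dots> = (270 * T + 26244 * T ^ 2 + 531441 * T ^ 3) * t ^ 2 + (36 * T + 729 * T ^ 2) * t + T"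
    by (simp only: t1[symmetric] t2[symmetric])
  finally show "t ^ 3 = (270 * T + 26244 * T ^ 2 + 531441 * T ^ 3) * t ^ 2 + (36 * T + 729 * T ^ 2) * t + T"
    by (simp only: power2_eq_square power3_eq_cube mult.assoc)
  show "z * t = (9 * T + 729 * T ^ 2) + (108 * T + 6561 * T ^ 2) * z + (1 + 486 * T + 19683 * T ^ 2) * z ^ 2"
    by (subst t1, subst zmult) algebra
  show "z * t ^ 2 = (T + 2187 * T ^ 2 + 433026 * T ^ 3 + 23914845 * T ^ 4 + 387420489 * T ^ 5) + (27 * T + 28431 * T ^ 2 + 4605822 * T ^ 3 + 229582512 * T ^ 4 + 3486784401 * T ^ 5) * z + (324 * T + 157464 * T ^ 2 + 18600435 * T ^ 3 + 774840978 * T ^ 4 + 10460353203 * T ^ 5) * z ^ 2"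
    by (subst t2, subst zmult) algebra
qed

subsection \<open>Divisibility of the trisections\<close>

text \<open>The subring \<open>\<int>[y]\<close>, given by closure rules so that membership of
  explicit polynomials follows by introduction.\<close>

inductive_set int_adjoin :: "'a::comm_ring_1 \<Rightarrow> 'a set" for y where
  of_int: "of_int c \<in> int_adjoin y"
| gen: "y \<in> int_adjoin y"
| add: "\<lbrakk>f \<in> int_adjoin y; g \<in> int_adjoin y\<rbrakk> \<Longrightarrow> f + g \<in> int_adjoin y"
| mult: "\<lbrakk>f \<in> int_adjoin y; g \<in> int_adjoin y\<rbrakk> \<Longrightarrow> f * g \<in> int_adjoin y"

lemma int_adjoin_numeral: "numeral w \<in> int_adjoin y"
  using int_adjoin.of_int[of "numeral w" y] by simp

lemma int_adjoin_power: "f \<in> int_adjoin y \<Longrightarrow> f ^ n \<in> int_adjoin y"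
  using int_adjoin.of_int[of 1 y] by (induction n) (auto intro: int_adjoin.mult)

lemmas int_adjoin_intros = int_adjoin.gen int_adjoin.add int_adjoin.mult int_adjoin_numeral int_adjoin_power

text \<open>Reduces a claim about \<open>g \<int>[y]\<close> to the products of \<open>g\<close>
  with powers of \<open>y\<close>. The induction keeps \<open>g\<close> and the exponent general, so
  that a product \<open>f * h\<close> is handled by first absorbing \<open>f\<close> into
  \<open>g\<close>.\<close>

lemma additive_int_adjoin:
  fixes L :: "'a::comm_ring_1 \<Rightarrow> 'b::comm_ring_1"
  assumes L_add: "\<And>f g. L (f + g) = L f + L g"
    and L_of_int: "\<And>c f. L (of_int c * f) = of_int c * L f"
    and M_add: "\<And>f g. f \<in> M \<Longrightarrow> g \<in> M \<Longrightarrow> f + g \<in> M"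
    and M_of_int: "\<And>c f. f \<in> M \<Longrightarrow> of_int c * f \<in> M"
    and L_powers: "\<And>j. L (g * y ^ j) \<in> M"
    and f: "f \<in> int_adjoin y"
  shows "L (g * f) \<in> M"
proof -
  have "\<forall>j. L (g * f * y ^ j) \<in> M" if "\<forall>j. L (g * y ^ j) \<in> M" for g
    using f that
  proof (induction arbitrary: g)
    case (of_int c)
    have "L (g * of_int c * y ^ j) = of_int c * L (g * y ^ j)" for j
      unfolding L_of_int[symmetric] by (simp only: mult_ac)
    with of_int show ?case by (simp add: M_of_int)
  next
    case gen
    have "g * y * y ^ j = g * y ^ Suc j" for j by (simp add: mult.assoc)
    with gen show ?case by (simp only:) blast
  next
    case (add f h)
    then show ?case by (simp add: ring_distribs L_add M_add)
  next
    case (mult f h)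
    then show ?case by (simp only: mult.assoc[symmetric]) blast
  qed
  from this[of g] L_powers have "L (g * f * y ^ 0) \<in> M" by blast
  then show ?thesis by simp
qed

lemmas haupt9_modular = modular_equation[OF haupt9_cubed haupt3_eq]

lemma haupt_products_quadratic:
  "haupt9 * haupt3 = dilate3 (9 * haupt3 + 729 * haupt3 ^ 2) +
    dilate3 (108 * haupt3 + 6561 * haupt3 ^ 2) * haupt9 +
    dilate3 (1 + 486 * haupt3 + 19683 * haupt3 ^ 2) * haupt9 ^ 2"
  "haupt9 * haupt3 ^ 2 = dilate3 (haupt3 + 2187 * haupt3 ^ 2 + 433026 * haupt3 ^ 3 + 23914845 * haupt3 ^ 4 + 387420489 * haupt3 ^ 5) +
    dilate3 (27 * haupt3 + 28431 * haupt3 ^ 2 + 4605822 * haupt3 ^ 3 + 229582512 * haupt3 ^ 4 + 3486784401 * haupt3 ^ 5) * haupt9 +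
    dilate3 (324 * haupt3 + 157464 * haupt3 ^ 2 + 18600435 * haupt3 ^ 3 + 774840978 * haupt3 ^ 4 + 10460353203 * haupt3 ^ 5) * haupt9 ^ 2"
  by (simp_all only: haupt9_modular(1,2) dilate3_hom dilate3_mult dilate3_power)

lemma trisect_0_haupt_products:
  "trisect 0 (haupt9 * haupt3) = 15 * haupt3 + 4860 * haupt3 ^ 2 + 295245 * haupt3 ^ 3
     + 4782969 * haupt3 ^ 4"
  "trisect 0 (haupt9 * haupt3 ^ 2) = haupt3 + 4374 * haupt3 ^ 2 + 1712421 * haupt3 ^ 3
     + 215233605 * haupt3 ^ 4 + 11622614670 * haupt3 ^ 5 + 282429536481 * haupt3 ^ 6
     + 2541865828329 * haupt3 ^ 7"
proof -
  show "trisect 0 (haupt9 * haupt3) = 15 * haupt3 + 4860 * haupt3 ^ 2 + 295245 * haupt3 ^ 3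
     + 4782969 * haupt3 ^ 4"
    unfolding haupt_products_quadratic(1) trisect_0_quadratic
    by algebra
  show "trisect 0 (haupt9 * haupt3 ^ 2) = haupt3 + 4374 * haupt3 ^ 2 + 1712421 * haupt3 ^ 3
     + 215233605 * haupt3 ^ 4 + 11622614670 * haupt3 ^ 5 + 282429536481 * haupt3 ^ 6
     + 2541865828329 * haupt3 ^ 7"
    unfolding haupt_products_quadratic(2) trisect_0_quadratic
    by algebra
qed

text \<open>By \<open>trisect_1_quadratic\<close> only the coefficient of \<open>z\<close> and
  \<open>27 t\<close> times that of \<open>z^2\<close> enter, and here every coefficient of
  \<open>z\<close> is a multiple of 27.\<close>

lemma trisect_1_haupt_products:
  "27 dvd trisect (Suc 0) (haupt9 * haupt3)"
  "27 dvd trisect (Suc 0) (haupt9 * haupt3 ^ 2)"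
proof -
  have "trisect (Suc 0) (haupt9 * haupt3) = 27 * ((4 * haupt3 + 243 * haupt3 ^ 2 + haupt3 *
      (1 + 486 * haupt3 + 19683 * haupt3 ^ 2)) * (eta_ratio * cubic_part ^ 2))"
    unfolding haupt_products_quadratic(1) trisect_1_quadratic by algebra
  then show "27 dvd trisect (Suc 0) (haupt9 * haupt3)" by (rule dvdI)
  have "trisect (Suc 0) (haupt9 * haupt3 ^ 2) = 27 * ((haupt3 + 1053 * haupt3 ^ 2 + 170586 * haupt3 ^ 3 + 8503056 * haupt3 ^ 4 + 129140163 * haupt3 ^ 5 + haupt3 *
      (324 * haupt3 + 157464 * haupt3 ^ 2 + 18600435 * haupt3 ^ 3 + 774840978 * haupt3 ^ 4 + 10460353203 * haupt3 ^ 5)) * (eta_ratio * cubic_part ^ 2))"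
    unfolding haupt_products_quadratic(2) trisect_1_quadratic by algebra
  then show "27 dvd trisect (Suc 0) (haupt9 * haupt3 ^ 2)" by (rule dvdI)
qed

text \<open>
  For \<open>y = 9 haupt3\<close>, the cubic equation of \<open>y\<close> over the series in \<open>q\<^sup>3\<close> has all its coefficients
  in \<open>\<int>[y(q\<^sup>3)]\<close>, so that only the first three powers of \<open>y\<close> have to be checked. The
  scaling by 9 is what makes the extra factor 3 survive in each step.
\<close>

lemma trisect_0_invariant:
  assumes "f \<in> int_adjoin (9 * haupt3)"
  shows "\<exists>g\<in>int_adjoin (9 * haupt3). trisect 0 (haupt9 * haupt3 * f) = 3 * (haupt3 * g)"
proof -
  let ?t = haupt3 and ?y = "9 * haupt3"
  define M where "M = (\<lambda>g. 3 * (?t * g)) ` int_adjoin ?y"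
  have M_add: "a + b \<in> M" if "a \<in> M" "b \<in> M" for a b
  proof -
    from that obtain g h where gh: "g \<in> int_adjoin ?y" "h \<in> int_adjoin ?y"
      "a = 3 * (?t * g)" "b = 3 * (?t * h)" by (auto simp: M_def)
    then have "a + b = 3 * (?t * (g + h))" by (simp only: ring_distribs)
    then show ?thesis unfolding M_def by (rule image_eqI) (rule int_adjoin.add[OF gh(1,2)])
  qed
  have M_mult: "c * a \<in> M" if "a \<in> M" "c \<in> int_adjoin ?y" for a c
  proof -
    from that obtain g where g: "g \<in> int_adjoin ?y" "a = 3 * (?t * g)" by (auto simp: M_def)
    then have "c * a = 3 * (?t * (c * g))" by (simp only: mult_ac)
    then show ?thesis unfolding M_def by (rule image_eqI) (rule int_adjoin.mult[OF that(2) g(1)])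
  qed
  define W where "W j = trisect 0 (haupt9 * ?t * ?y ^ j)" for j
  have W0: "W 0 \<in> M"
  proof -
    have "W 0 = 3 * (?t * (5 + 180 * ?y + 1215 * ?y ^ 2 + 2187 * ?y ^ 3))"
      unfolding W_def power_0 mult_1_right trisect_0_haupt_products(1) by algebra
    then show ?thesis unfolding M_def by (rule image_eqI) (intro int_adjoin_intros)
  qed
  have W1: "W 1 \<in> M"
  proof -
    have "W 1 = trisect 0 (9 * (haupt9 * ?t ^ 2))"
      by (simp add: W_def power2_eq_square mult_ac)
    also have "\<dots> = 9 * trisect 0 (haupt9 * ?t ^ 2)" by simp
    also have "\<dots> = 3 * (?t * (3 + 1458 * ?y + 63423 * ?y ^ 2 + 885735 * ?y ^ 3 + 5314410 * ?y ^ 4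
        + 14348907 * ?y ^ 5 + 14348907 * ?y ^ 6))"
      unfolding trisect_0_haupt_products(2) by algebra
    finally show ?thesis unfolding M_def by (rule image_eqI) (intro int_adjoin_intros)
  qed
  \<comment> \<open>With \<open>Y = y(q^3)\<close>, 729 times the cubic for \<open>haupt3\<close>
    reads \<open>y^3 = s1(Y) y^2 + s2(Y) y + 81 Y\<close>, which gives a recurrence of order
    3.\<close>
  let ?s1 = "270 * ?y + 2916 * ?y ^ 2 + 6561 * ?y ^ 3" and ?s2 = "324 * ?y + 729 * ?y ^ 2"
  have rec: "trisect 0 (haupt9 * ?t * ?y ^ 2 * (?y * h)) =
      ?s1 * trisect 0 (haupt9 * ?t * (?y * (?y * h))) + ?s2 * trisect 0 (haupt9 * ?t * (?y * h))
        + 9 * ?y * trisect 0 (9 * haupt9 * ?t * h)" for h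
  proof -
    have "haupt9 * ?t * ?y ^ 2 * (?y * h) = 729 * haupt9 * ?t * h * ?t ^ 3"
      by algebra
    also have "\<dots> = dilate3 ?s1 * (haupt9 * ?t * (?y * (?y * h))) + dilate3 ?s2 * (haupt9 * ?t * (?y * h))
        + dilate3 (9 * ?y) * (9 * haupt9 * ?t * h)"
      unfolding haupt9_modular(3) dilate3_hom dilate3_mult dilate3_power by algebra
    finally show ?thesis by (simp only: trisect_add trisect_dilate3_mult zero_less_numeral)
  qed
  have W_rec: "W (j + 3) = ?s1 * W (j + 2) + ?s2 * W (j + 1) + 81 * ?y * W j" for j
  proof -
    have "W (j + 3) = trisect 0 (haupt9 * ?t * ?y ^ 2 * (?y * ?y ^ j))"
      by (simp only: W_def power_add power3_eq_cube power2_eq_square mult_ac)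
    also have "\<dots> = ?s1 * W (j + 2) + ?s2 * W (j + 1) + 9 * ?y * trisect 0 (9 * (haupt9 * ?t * ?y ^ j))"
      unfolding rec by (simp only: W_def power_add power_one_right power2_eq_square mult_ac)
    finally show ?thesis by (simp add: W_def)
  qed
  \<comment> \<open>The same recurrence at \<open>j = -1\<close>: there \<open>haupt9 / 9\<close>
    plays the role of \<open>haupt9 * haupt3 * y^j\<close>, so the known section of
    \<open>haupt9\<close> replaces an expansion of \<open>haupt3^3\<close>.\<close>
  have W2: "W 2 \<in> M"
  proof -
    have "W 2 = trisect 0 (81 * (haupt9 * ?t ^ 3))"
      by (simp add: W_def power2_eq_square power3_eq_cube mult_ac)
    also have "81 * (haupt9 * ?t ^ 3) = dilate3 ?s1 * (haupt9 * ?t * ?y) + dilate3 ?s2 * (haupt9 * ?t)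
        + dilate3 (9 * ?y) * haupt9"
      unfolding haupt9_modular(3) dilate3_hom dilate3_mult dilate3_power by algebra
    also have "trisect 0 \<dots> = ?s1 * W 1 + ?s2 * W 0 + 9 * ?y * trisect 0 haupt9"
      by (simp only: trisect_add trisect_dilate3_mult zero_less_numeral W_def power_0 power_one_right mult_1_right)
    finally have W2: "W 2 = ?s1 * W 1 + ?s2 * W 0 + 9 * ?y * trisect 0 haupt9" .
    have "9 * ?y * trisect 0 haupt9 = 3 * (?t * (27 * ?y))"
      unfolding trisect_haupt9 by algebra
    then have *: "9 * ?y * trisect 0 haupt9 \<in> M"
      unfolding M_def by (rule image_eqI) (intro int_adjoin_intros)
    show ?thesis unfolding W2
      by (rule M_add[OF M_add[OF M_mult[OF W1] M_mult[OF W0]] *]) (intro int_adjoin_intros)+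
  qed
  have "W j \<in> M" for j
  proof (induction j rule: less_induct)
    case (less j)
    show ?case
    proof (cases "j < 3")
      case True
      then have "j = 0 \<or> j = 1 \<or> j = 2" by auto
      with W0 W1 W2 show ?thesis by blast
    next
      case False
      then obtain i where j: "j = i + 3" by (metis le_add_diff_inverse2 not_less)
      show ?thesis unfolding j W_rec
        by (intro M_add M_mult less int_adjoin_intros) (simp_all add: j)
    qed
  qed
  then have "trisect 0 (haupt9 * ?t * f) \<in> M"
    unfolding W_def
    by (intro additive_int_adjoin[OF trisect_add trisect_const_mult(1) _ _ _ assms])
       (simp_all add: M_add M_mult int_adjoin.of_int)
  then show ?thesis by (auto simp: M_def)
qed

text \<open>From \<open>j = 2\<close> on, \<open>(9t)^j\<close> already contains the factor 81, so
  only the powers 0 and 1 need the explicit trisections.\<close>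

lemma trisect_1_invariant:
  assumes "f \<in> int_adjoin (9 * haupt3)"
  shows "27 dvd trisect (Suc 0) (haupt9 * haupt3 * f)"
proof -
  have "27 dvd trisect (Suc 0) (haupt9 * haupt3 * (9 * haupt3) ^ j)" for j
  proof -
    consider "j = 0" | "j = 1" | i where "j = i + 2"
    proof (cases "j < 2")
      case True
      then have "j = 0 \<or> j = 1" by auto
      with that show ?thesis by blast
    next
      case False
      then have "j = (j - 2) + 2" by simp
      with that show ?thesis by blast
    qed
    then show ?thesis
    proof cases
      case 1
      then show ?thesis by (simp add: trisect_1_haupt_products)
    next
      case 2
      have eq: "haupt9 * haupt3 * (9 * haupt3) ^ j = 9 * (haupt9 * haupt3 ^ 2)"
        by (simp add: 2 power2_eq_square mult_ac)
      show ?thesis unfolding eq trisect_const_mult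
        by (rule dvd_mult[OF trisect_1_haupt_products(2)])
    next
      case 3
      have eq: "haupt9 * haupt3 * (9 * haupt3) ^ j = 27 * (3 * (haupt9 * haupt3 ^ 3 * (9 * haupt3) ^ i))"
        by (simp add: 3 power_add power2_eq_square power3_eq_cube mult_ac)
      show ?thesis unfolding eq trisect_const_mult by (rule dvd_triv_left)
    qed
  qed
  then have "trisect (Suc 0) (haupt9 * haupt3 * f) \<in> {g. 27 dvd g}"
    by (intro additive_int_adjoin[OF trisect_add trisect_const_mult(1) _ _ _ assms]) (simp_all add: dvd_add)
  then show ?thesis by simp
qed

section \<open>Generating functions along the progressions\<close>

definition p33_progression :: "nat \<Rightarrow> int fps" where
  "p33_progression \<alpha> = Abs_fps (\<lambda>n. p33 (3 ^ \<alpha> * n + (3 ^ \<alpha> + 1) div 2))"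

lemma trisect_Abs_fps_p33: "trisect 2 (Abs_fps p33) = p33_progression 1"
  by (simp add: fps_eq_iff p33_progression_def)

text \<open>The offsets satisfy
  \<open>3^\<alpha> + (3^\<alpha> + 1)/2 = (3^(\<alpha>+1) + 1)/2\<close>; oddness of the power
  makes the halving exact.\<close>

lemma trisect_p33_progression: "trisect (Suc 0) (p33_progression \<alpha>) = p33_progression (Suc \<alpha>)"
proof (rule fps_ext)
  fix n
  have "odd ((3::nat) ^ \<alpha>)" by simp
  then obtain k where k: "(3::nat) ^ \<alpha> = 2 * k + 1" by (rule oddE)
  have eq: "3 ^ \<alpha> * (3 * n + Suc 0) + (3 ^ \<alpha> + 1) div 2 = 3 ^ Suc \<alpha> * n + (3 ^ Suc \<alpha> + 1) div (2::nat)"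
    unfolding power_Suc k by (simp add: algebra_simps)
  show "fps_nth (trisect (Suc 0) (p33_progression \<alpha>)) n = fps_nth (p33_progression (Suc \<alpha>)) n"
    by (simp only: p33_progression_def trisect_nth fps_nth_Abs_fps eq)
qed

lemma p33_denom_eq: "p33_denom = euler ^ 3 * euler3 ^ 3"
  by (simp add: p33_denom_def dilate3_euler) (simp add: euler_def)

text \<open>Multiplication by \<open>haupt9\<close> turns the denominator into a series in
  \<open>q^3\<close>, which can then be pulled out of a section.\<close>

lemma haupt9_mult_p33_denom: "haupt9 * p33_denom = fps_X * dilate3 p33_denom"
proof -
  have "haupt9 * p33_denom = fps_X * (euler9 ^ 3 * euler3 ^ 3) * (euler * euler_inv) ^ 3"
    by (simp only: haupt9_def p33_denom_eq power_mult_distrib mult_ac)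
  also have "euler9 ^ 3 * euler3 ^ 3 = dilate3 p33_denom"
    by (simp add: p33_denom_eq dilate3_mult dilate3_power mult_ac)
  finally show ?thesis by simp
qed

lemma p33_denom_unit:
  assumes "f * p33_denom = g"
  shows "f = g * Abs_fps p33"
proof -
  have "f = f * (Abs_fps p33 * p33_denom)" by (simp add: p33_generating_function)
  also have "\<dots> = (f * p33_denom) * Abs_fps p33" by (simp only: mult_ac)
  finally show ?thesis by (simp only: assms)
qed

text \<open>For \<alpha> = 1 the two factors 3 come from section 0 of \<open>haupt9\<close>; each
  further step gains one by \<open>trisect_0_invariant\<close>.\<close>

lemma p33_progression_form:
  assumes "\<alpha> \<ge> 1"
  shows "\<exists>f\<in>int_adjoin (9 * haupt3).
    fps_X * p33_progression \<alpha> * p33_denom = 3 ^ (\<alpha> + 1) * (haupt3 * f)"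
  using assms
proof (induction \<alpha> rule: dec_induct)
  case base
  have "haupt9 = haupt9 * p33_denom * Abs_fps p33"
    using p33_generating_function by (simp add: mult_ac)
  also have "\<dots> = dilate3 p33_denom * (fps_X * Abs_fps p33)"
    unfolding haupt9_mult_p33_denom by (simp only: mult_ac)
  finally have "trisect 0 haupt9 = trisect 0 (dilate3 p33_denom * (fps_X * Abs_fps p33))" by simp
  then have "9 * haupt3 = p33_denom * (fps_X * p33_progression 1)"
    by (simp add: trisect_dilate3_mult trisect_X_mult trisect_haupt9 trisect_Abs_fps_p33)
  moreover have "1 \<in> int_adjoin (9 * haupt3)" using int_adjoin.of_int[of 1] by simp
  ultimately show ?case by (intro bexI[of _ 1]) (simp_all add: mult_ac)
next
  case (step \<alpha>)
  then obtain f where f: "f \<in> int_adjoin (9 * haupt3)"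
    and eq: "fps_X * p33_progression \<alpha> * p33_denom = 3 ^ (\<alpha> + 1) * (haupt3 * f)" by blast
  have c: "trisect r (3 ^ k * h) = 3 ^ k * trisect r h" for r k and h :: "int fps"
    using trisect_const_mult(1)[of r "3 ^ k" h] by simp
  \<comment> \<open>The two factors \<open>X\<close> shift section 1 of the progression, the one
    leading to \<open>Suc \<alpha>\<close>, into section 0.\<close>
  have "dilate3 p33_denom * (fps_X * (fps_X * p33_progression \<alpha>)) =
      fps_X * p33_progression \<alpha> * (fps_X * dilate3 p33_denom)"
    by (simp only: mult_ac)
  also have "\<dots> = haupt9 * (fps_X * p33_progression \<alpha> * p33_denom)"
    unfolding haupt9_mult_p33_denom[symmetric] by (simp only: mult_ac)
  also have "\<dots> = 3 ^ (\<alpha> + 1) * (haupt9 * haupt3 * f)"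
    unfolding eq by (simp only: mult_ac)
  finally have "trisect 0 (dilate3 p33_denom * (fps_X * (fps_X * p33_progression \<alpha>))) =
      3 ^ (\<alpha> + 1) * trisect 0 (haupt9 * haupt3 * f)"
    by (simp only: c)
  then have "p33_denom * (fps_X * p33_progression (Suc \<alpha>)) = 3 ^ (\<alpha> + 1) * trisect 0 (haupt9 * haupt3 * f)"
    by (simp add: trisect_dilate3_mult trisect_X_mult trisect_p33_progression)
  moreover obtain g where "g \<in> int_adjoin (9 * haupt3)"
    "trisect 0 (haupt9 * haupt3 * f) = 3 * (haupt3 * g)"
    using trisect_0_invariant[OF f] by blast
  ultimately show ?case by (intro bexI[of _ g]) (simp_all add: mult_ac)
qed

lemma dvd_fps_nth:
  assumes "of_int c dvd (f :: int fps)"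
  shows "c dvd fps_nth f n"
  using assms by (auto simp: dvd_def simp flip: fps_of_int)

text \<open>The denominator is a unit, so the divisibility passes to the progression. In the second
  claim, section 1 of \<open>haupt9 * haupt3 * f\<close> adds the factor 27 on the indices
  \<open>3n + 2\<close>.\<close>

lemma dvd_p33_progression:
  assumes "\<alpha> \<ge> 1"
  shows "3 ^ (\<alpha> + 1) dvd fps_nth (p33_progression \<alpha>) n"
    and "3 ^ (\<alpha> + 4) dvd fps_nth (p33_progression \<alpha>) (3 * n + 2)"
proof -
  obtain f where f: "f \<in> int_adjoin (9 * haupt3)"
    and eq: "fps_X * p33_progression \<alpha> * p33_denom = 3 ^ (\<alpha> + 1) * (haupt3 * f)"
    using p33_progression_form[OF assms] by blast
  have "fps_X * (p33_progression \<alpha> * p33_denom) = fps_X * (3 ^ (\<alpha> + 1) * (eta_ratio * f))"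
    using eq by (simp only: haupt3_def mult_ac)
  then have "p33_progression \<alpha> * p33_denom = 3 ^ (\<alpha> + 1) * (eta_ratio * f)"
    by simp
  then have "p33_progression \<alpha> = 3 ^ (\<alpha> + 1) * (eta_ratio * f) * Abs_fps p33"
    by (rule p33_denom_unit)
  then show "3 ^ (\<alpha> + 1) dvd fps_nth (p33_progression \<alpha>) n"
    by (intro dvd_fps_nth) (simp add: mult.assoc)
  have c: "trisect r (3 ^ k * h) = 3 ^ k * trisect r h" for r k and h :: "int fps"
    using trisect_const_mult(1)[of r "3 ^ k" h] by simp
  have "dilate3 p33_denom * (fps_X * (fps_X * p33_progression \<alpha>)) =
      fps_X * p33_progression \<alpha> * (fps_X * dilate3 p33_denom)"
    by (simp only: mult_ac)
  also have "\<dots> = haupt9 * (fps_X * p33_progression \<alpha> * p33_denom)"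
    unfolding haupt9_mult_p33_denom[symmetric] by (simp only: mult_ac)
  also have "\<dots> = 3 ^ (\<alpha> + 1) * (haupt9 * haupt3 * f)"
    unfolding eq by (simp only: mult_ac)
  finally have "trisect (Suc 0) (dilate3 p33_denom * (fps_X * (fps_X * p33_progression \<alpha>))) =
      3 ^ (\<alpha> + 1) * trisect (Suc 0) (haupt9 * haupt3 * f)"
    by (simp only: c)
  moreover have lt: "Suc 0 < 3" by simp
  ultimately have eq1: "fps_X * trisect 2 (p33_progression \<alpha>) * p33_denom = 3 ^ (\<alpha> + 1) * trisect (Suc 0) (haupt9 * haupt3 * f)"
    by (simp only: trisect_dilate3_mult[OF lt] trisect_X_mult) (simp only: mult_ac)
  obtain h where h: "trisect (Suc 0) (haupt9 * haupt3 * f) = 27 * h"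
    using trisect_1_invariant[OF f] by (rule dvdE)
  have "fps_X * trisect 2 (p33_progression \<alpha>) = 3 ^ (\<alpha> + 4) * h * Abs_fps p33"
    by (rule p33_denom_unit) (simp add: eq1 h power_add)
  \<comment> \<open>The index \<open>Suc n\<close> compensates for the factor \<open>X\<close> left
    over from the shift.\<close>
  then have "3 ^ (\<alpha> + 4) dvd fps_nth (fps_X * trisect 2 (p33_progression \<alpha>)) (Suc n)"
    by (intro dvd_fps_nth) (simp add: mult.assoc)
  then show "3 ^ (\<alpha> + 4) dvd fps_nth (p33_progression \<alpha>) (3 * n + 2)"
    by simp
qed

theorem theorem1p2:
  fixes n \<alpha> :: nat
  assumes "\<alpha> \<ge> 1"
  shows "[p33 (3 ^ \<alpha> * n + (3 ^ \<alpha> + 1) div 2) = 0] (mod 3 ^ (\<alpha> + 1)) \<and>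
         [p33 (3 ^ (\<alpha> + 1) * n + (5 * 3 ^ \<alpha> + 1) div 2) = 0] (mod 3 ^ (\<alpha> + 4))"
proof
  show "[p33 (3 ^ \<alpha> * n + (3 ^ \<alpha> + 1) div 2) = 0] (mod 3 ^ (\<alpha> + 1))"
    using dvd_p33_progression(1)[OF assms, of n]
    by (simp only: cong_0_iff p33_progression_def fps_nth_Abs_fps)
  have "odd ((3::nat) ^ \<alpha>)" by simp
  then obtain k where k: "(3::nat) ^ \<alpha> = 2 * k + 1" by (rule oddE)
  have eq: "3 ^ \<alpha> * (3 * n + 2) + (3 ^ \<alpha> + 1) div 2 = 3 ^ (\<alpha> + 1) * n + (5 * 3 ^ \<alpha> + 1) div (2::nat)"
    unfolding power_add k by (simp add: algebra_simps)
  show "[p33 (3 ^ (\<alpha> + 1) * n + (5 * 3 ^ \<alpha> + 1) div 2) = 0] (mod 3 ^ (\<alpha> + 4))"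
    using dvd_p33_progression(2)[OF assms, of n]
    by (simp only: cong_0_iff p33_progression_def fps_nth_Abs_fps eq)
qed

end
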